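(* Let $\gamma,\alpha\in(0,1)$ and let $(\theta_i,Z_i)_{i\in[m]}$ follow the i.i.d. two-group model described in the context, with $\pi$, $f_0$, $f$ known. Then the oracle procedure described in the context (Procedure 1 with parameters $(\gamma,\alpha)$) controls the false discovery exceedance at level $(\gamma,\alpha)$: if $\boldsymbol{\delta}=(\delta_1,\dots,\delta_m)\in\{0,1\}^m$ denotes its decision vector, then $$\mathbb{P}\left(\frac{\sum_{i=1}^m(1-\theta_i)\delta_i}{\max\{\sum_{i=1}^m\delta_i,\,1\}}>\gamma\right)\le\alpha .$$
   Context: Two-group model: $[m]=\{1,\dots,m\}$; $\theta_1,\dots,\theta_m$ are i.i.d. Bernoulli$(\pi)$ with $\pi=\mathbb{P}(\theta_i=1)$ ($\theta_i=0$ means the $i$-th null hypothesis $H_i^0$ is true). Given $\boldsymbol\theta=(\theta_i)_{i\in[m]}$, the observations $Z_1,\dots,Z_m$ are independent, and $Z_i$ has distribution $F_0$ (density $f_0$) if $\theta_i=0$ and $F_1$ (density $f_1$) if $\theta_i=1$. Let $f=(1-\pi)f_0+\pi f_1$ and $\boldsymbol{Z}=(Z_i)_{i\in[m]}$. Local false discovery rate (lfdr): $T_i^{OR}=\mathbb{P}(\theta_i=0\mid Z_i)=(1-\pi)f_0(Z_i)/f(Z_i)$. Poisson binomial distribution: $\mathrm{PBD}(k,\boldsymbol p)$ with $\boldsymbol p=(p_1,\dots,p_k)$ is the law of a sum of $k$ independent Bernoulli variables with success probabilities $p_1,\dots,p_k$; $\mathbb{P}(\mathrm{PBD}(k,\boldsymbol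 p)>x)$ denotes the probability that a variable with this law exceeds $x$. Procedure 1 (parameters $\gamma,\alpha$): 1. Sort the lfdr statistics in ascending order, $T^{OR}_{(1)}\le\dots\le T^{OR}_{(m)}$ (ties broken arbitrarily as a function of $\boldsymbol Z$), with corresponding null hypotheses $H^0_{(1)},\dots,H^0_{(m)}$. Let $\mathcal R_k$ be the set of indices of the first $k$ hypotheses in this order. 2. With $\boldsymbol p^{(k)}=(T^{OR}_{(1)},\dots,T^{OR}_{(k)})$, let $K=\max\{k:\mathbb{P}(\mathrm{PBD}(k,\boldsymbol p^{(k)})>\gamma k)\le\alpha\}$ (with $K=0$ if no $k\in[m]$ qualifies), where this probability is computed with the realized values $\boldsymbol p^{(k)}$ held fixed. Reject $H^0_{(1)},\dots,H^0_{(K)}$. 3. If $K<m$, additionally reject $H^0_{(K+1)}$ with probability $$\frac{\alpha-\mathbb{P}\left(\sum_{i\in\mathcal R_K}(1-\theta_i)>\gamma K\mid\boldsymbol Z\right)}{\mathbb{P}\left(\sum_{i\in\mathcal R_{K+1}}(1-\theta_i)>\gamma(K+1)\mid\boldsymbol Z\right)-\mathbb{P}\left(\sum_{i\in\mathcal R_K}(1-\theta_i)>\gamma K\mid\boldsymbol Z\right)},$$ the randomization being carried out, given $\boldsymbol Z$, independently of $\boldsymbol\theta$. The decision vector has $\delta_i=1$ if $H_i^0$ is rejected and $\delta_i=0$ otherwise. *)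

theory Defs
  imports "HOL-Probability.Probability"
begin

text \<open>
  The true state is a Boolean: \<open>\<theta> i \<omega>\<close> encodes \<open>\<theta>\<^sub>i = 1\<close>, that is, the
  \<open>i\<close>-th null hypothesis is false. The densities are taken with respect to an arbitrary dominating
  measure \<open>\<nu>\<close> on the observation space; conditioning on \<open>\<theta>\<close> is elementary because \<open>\<theta>\<close> takes
  finitely many values.
\<close>

locale two_group_model = prob_space M
  for M :: "'w measure"
    and m :: nat and \<pi> :: real
    and \<nu> :: "'z measure" and f0 f1 :: "'z \<Rightarrow> real"
    and \<theta> :: "nat \<Rightarrow> 'w \<Rightarrow> bool" and Z :: "nat \<Rightarrow> 'w \<Rightarrow> 'z" +
  assumes pi_range: "0 \<le> \<pi>" "\<pi> \<le> 1"
    and f0_measurable: "f0 \<in> borel_measurable \<nu>"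
    and f1_measurable: "f1 \<in> borel_measurable \<nu>"
    and f0_nonneg: "\<And>z. 0 \<le> f0 z"
    and f1_nonneg: "\<And>z. 0 \<le> f1 z"
    and F0_prob: "prob_space (density \<nu> f0)"
    and F1_prob: "prob_space (density \<nu> f1)"
    and theta_indep: "indep_vars (\<lambda>_. count_space UNIV) \<theta> {1..m}"
    and theta_distr:
      "\<And>i. i \<in> {1..m} \<Longrightarrow>
         distr M (count_space UNIV) (\<theta> i) = measure_pmf (bernoulli_pmf \<pi>)"
    and Z_measurable: "\<And>i. i \<in> {1..m} \<Longrightarrow> Z i \<in> measurable M \<nu>"
    and Z_indep_given_theta:
      "\<And>t. prob {\<omega> \<in> space M. \<forall>i\<in>{1..m}. \<theta> i \<omega> = t i} > 0 \<Longrightarrow>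
         prob_space.indep_vars
           (uniform_measure M {\<omega> \<in> space M. \<forall>i\<in>{1..m}. \<theta> i \<omega> = t i}) (\<lambda>_. \<nu>) Z {1..m}"
    and Z_distr_given_theta:
      "\<And>t i. prob {\<omega> \<in> space M. \<forall>i\<in>{1..m}. \<theta> i \<omega> = t i} > 0 \<Longrightarrow> i \<in> {1..m} \<Longrightarrow>
         distributed
           (uniform_measure M {\<omega> \<in> space M. \<forall>i\<in>{1..m}. \<theta> i \<omega> = t i}) \<nu> (Z i)
           (\<lambda>z. ennreal (if t i then f1 z else f0 z))"

definition mixture_density :: "real \<Rightarrow> ('z \<Rightarrow> real) \<Rightarrow> ('z \<Rightarrow> real) \<Rightarrow> 'z \<Rightarrow> real" where
  "mixture_density \<pi> f0 f1 z = (1 - \<pi>) * f0 z + \<pi> * f1 z"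

text \<open>Where the mixture density vanishes (an event of probability 0 for each observation),
  the quotient is \<open>0\<close> by the convention \<open>x / 0 = 0\<close>.\<close>

definition lfdr :: "real \<Rightarrow> ('z \<Rightarrow> real) \<Rightarrow> ('z \<Rightarrow> real) \<Rightarrow> 'z \<Rightarrow> real" where
  "lfdr \<pi> f0 f1 z = (1 - \<pi>) * f0 z / mixture_density \<pi> f0 f1 z"

definition poisson_binomial_pmf :: "nat \<Rightarrow> (nat \<Rightarrow> real) \<Rightarrow> nat pmf" where
  "poisson_binomial_pmf k p =
     map_pmf (\<lambda>x. \<Sum>j=1..k. of_bool (x j))
       (Pi_pmf {1..k} False (\<lambda>j. bernoulli_pmf (p j)))"

definition pbd_tail :: "nat \<Rightarrow> (nat \<Rightarrow> real) \<Rightarrow> real \<Rightarrow> real" where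
  "pbd_tail k p x = measure_pmf.prob (poisson_binomial_pmf k p) {n. real n > x}"

definition obs :: "nat \<Rightarrow> (nat \<Rightarrow> 'w \<Rightarrow> 'z) \<Rightarrow> 'w \<Rightarrow> nat \<Rightarrow> 'z" where
  "obs m Z \<omega> = (\<lambda>i\<in>{1..m}. Z i \<omega>)"

definition obs_algebra ::
    "'w measure \<Rightarrow> nat \<Rightarrow> 'z measure \<Rightarrow> (nat \<Rightarrow> 'w \<Rightarrow> 'z) \<Rightarrow> 'w measure" where
  "obs_algebra M m \<nu> Z = vimage_algebra (space M) (obs m Z) (Pi\<^sub>M {1..m} (\<lambda>_. \<nu>))"

text \<open>\<open>prob_given_obs M m \<nu> Z A\<close> is a version of the conditional probability of the event \<open>A\<close>
  given all the observations.\<close>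

definition prob_given_obs ::
    "'w measure \<Rightarrow> nat \<Rightarrow> 'z measure \<Rightarrow> (nat \<Rightarrow> 'w \<Rightarrow> 'z) \<Rightarrow> 'w set \<Rightarrow> 'w \<Rightarrow> real" where
  "prob_given_obs M m \<nu> Z A = real_cond_exp M (obs_algebra M m \<nu> Z) (indicator A)"

text \<open>\<open>ord z k\<close> is the index of the hypothesis with the \<open>k\<close>-th smallest lfdr when the observations
  are \<open>z\<close>. Any (measurable) way of breaking ties is allowed.\<close>

definition lfdr_ordering ::
    "nat \<Rightarrow> real \<Rightarrow> 'z measure \<Rightarrow> ('z \<Rightarrow> real) \<Rightarrow> ('z \<Rightarrow> real) \<Rightarrow>
     ((nat \<Rightarrow> 'z) \<Rightarrow> nat \<Rightarrow> nat) \<Rightarrow> bool" where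
  "lfdr_ordering m \<pi> \<nu> f0 f1 ord \<longleftrightarrow>
     (\<forall>z \<in> space (Pi\<^sub>M {1..m} (\<lambda>_. \<nu>)).
        bij_betw (ord z) {1..m} {1..m} \<and>
        mono_on {1..m} (\<lambda>k. lfdr \<pi> f0 f1 (z (ord z k)))) \<and>
     (\<forall>k \<in> {1..m}. (\<lambda>z. ord z k) \<in> measurable (Pi\<^sub>M {1..m} (\<lambda>_. \<nu>)) (count_space UNIV))"

text \<open>The restriction to ranks in \<open>{1..m}\<close> only matters for \<open>k > m\<close>, where \<open>ord z\<close> is
  unspecified.\<close>

definition first_hyps :: "nat \<Rightarrow> ((nat \<Rightarrow> 'z) \<Rightarrow> nat \<Rightarrow> nat) \<Rightarrow> (nat \<Rightarrow> 'z) \<Rightarrow> nat \<Rightarrow> nat set" where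
  "first_hyps m ord z k = ord z ` {j \<in> {1..m}. j \<le> k}"

definition oracle_K ::
    "nat \<Rightarrow> real \<Rightarrow> ('z \<Rightarrow> real) \<Rightarrow> ('z \<Rightarrow> real) \<Rightarrow> real \<Rightarrow> real \<Rightarrow>
     ((nat \<Rightarrow> 'z) \<Rightarrow> nat \<Rightarrow> nat) \<Rightarrow> (nat \<Rightarrow> 'z) \<Rightarrow> nat" where
  "oracle_K m \<pi> f0 f1 \<gamma> \<alpha> ord z =
     Max (insert 0 {k \<in> {1..m}.
       pbd_tail k (\<lambda>j. lfdr \<pi> f0 f1 (z (ord z j))) (\<gamma> * real k) \<le> \<alpha>})"

text \<open>The event that more than \<open>\<gamma> * k\<close> of the first \<open>k\<close> null hypotheses are true, where
  \<open>k\<close> may depend on the observations.\<close>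

definition exceed_event ::
    "'w measure \<Rightarrow> nat \<Rightarrow> (nat \<Rightarrow> 'w \<Rightarrow> bool) \<Rightarrow> (nat \<Rightarrow> 'w \<Rightarrow> 'z) \<Rightarrow> real \<Rightarrow>
     ((nat \<Rightarrow> 'z) \<Rightarrow> nat \<Rightarrow> nat) \<Rightarrow> ((nat \<Rightarrow> 'z) \<Rightarrow> nat) \<Rightarrow> 'w set" where
  "exceed_event M m \<theta> Z \<gamma> ord k =
     {\<omega> \<in> space M.
        (\<Sum>i \<in> first_hyps m ord (obs m Z \<omega>) (k (obs m Z \<omega>)). 1 - of_bool (\<theta> i \<omega>))
          > \<gamma> * real (k (obs m Z \<omega>))}"

definition extra_rejection_prob ::
    "'w measure \<Rightarrow> nat \<Rightarrow> real \<Rightarrow> 'z measure \<Rightarrow> ('z \<Rightarrow> real) \<Rightarrow> ('z \<Rightarrow> real) \<Rightarrow>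
     (nat \<Rightarrow> 'w \<Rightarrow> bool) \<Rightarrow> (nat \<Rightarrow> 'w \<Rightarrow> 'z) \<Rightarrow> real \<Rightarrow> real \<Rightarrow>
     ((nat \<Rightarrow> 'z) \<Rightarrow> nat \<Rightarrow> nat) \<Rightarrow> 'w \<Rightarrow> real" where
  "extra_rejection_prob M m \<pi> \<nu> f0 f1 \<theta> Z \<gamma> \<alpha> ord \<omega> =
     (let K = oracle_K m \<pi> f0 f1 \<gamma> \<alpha> ord;
          P = (\<lambda>k. prob_given_obs M m \<nu> Z (exceed_event M m \<theta> Z \<gamma> ord k) \<omega>)
      in (\<alpha> - P K) / (P (\<lambda>z. K z + 1) - P K))"

text \<open>\<open>coin\<close> is the outcome of the randomization. Its conditional probability
  given the observations is prescribed, and it is conditionally independent of \<open>\<theta>\<close>. Nothing is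
  required where all hypotheses are rejected already, since the coin is not used there.\<close>

definition oracle_randomization ::
    "'w measure \<Rightarrow> nat \<Rightarrow> real \<Rightarrow> 'z measure \<Rightarrow> ('z \<Rightarrow> real) \<Rightarrow> ('z \<Rightarrow> real) \<Rightarrow>
     (nat \<Rightarrow> 'w \<Rightarrow> bool) \<Rightarrow> (nat \<Rightarrow> 'w \<Rightarrow> 'z) \<Rightarrow> real \<Rightarrow> real \<Rightarrow>
     ((nat \<Rightarrow> 'z) \<Rightarrow> nat \<Rightarrow> nat) \<Rightarrow> ('w \<Rightarrow> bool) \<Rightarrow> bool" where
  "oracle_randomization M m \<pi> \<nu> f0 f1 \<theta> Z \<gamma> \<alpha> ord coin \<longleftrightarrow>
     coin \<in> measurable M (count_space UNIV) \<and>
     (AE \<omega> in M. oracle_K m \<pi> f0 f1 \<gamma> \<alpha> ord (obs m Z \<omega>) < m \<longrightarrow>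
        prob_given_obs M m \<nu> Z {\<omega> \<in> space M. coin \<omega>} \<omega>
          = extra_rejection_prob M m \<pi> \<nu> f0 f1 \<theta> Z \<gamma> \<alpha> ord \<omega>) \<and>
     (\<forall>t. AE \<omega> in M. oracle_K m \<pi> f0 f1 \<gamma> \<alpha> ord (obs m Z \<omega>) < m \<longrightarrow>
        prob_given_obs M m \<nu> Z {\<omega> \<in> space M. coin \<omega> \<and> (\<forall>i\<in>{1..m}. \<theta> i \<omega> = t i)} \<omega>
          = prob_given_obs M m \<nu> Z {\<omega> \<in> space M. coin \<omega>} \<omega>
            * prob_given_obs M m \<nu> Z {\<omega> \<in> space M. \<forall>i\<in>{1..m}. \<theta> i \<omega> = t i} \<omega>)"

definition oracle_decision ::
    "nat \<Rightarrow> real \<Rightarrow> ('z \<Rightarrow> real) \<Rightarrow> ('z \<Rightarrow> real) \<Rightarrow> (nat \<Rightarrow> 'w \<Rightarrow> 'z) \<Rightarrow> real \<Rightarrow> real \<Rightarrow>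
     ((nat \<Rightarrow> 'z) \<Rightarrow> nat \<Rightarrow> nat) \<Rightarrow> ('w \<Rightarrow> bool) \<Rightarrow> nat \<Rightarrow> 'w \<Rightarrow> real" where
  "oracle_decision m \<pi> f0 f1 Z \<gamma> \<alpha> ord coin i \<omega> =
     (let z = obs m Z \<omega>; K = oracle_K m \<pi> f0 f1 \<gamma> \<alpha> ord z
      in if i \<in> first_hyps m ord z K \<or> (K < m \<and> coin \<omega> \<and> i = ord z (K + 1)) then 1 else 0)"

end

theory Submission
  imports Defs
begin

text \<open>
  Given the observations \<open>Z = z\<close>, the null indicators are independent Bernoulli variables whose
  success probabilities are the lfdr values, because
  \<open>(1 - \<pi>) f0 = lfdr \<cdot> f\<close> and \<open>\<pi> f1 = (1 - lfdr) \<cdot> f\<close> pointwise. To obtain this without assuming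
  that \<open>\<nu>\<close> is \<open>\<sigma>\<close>-finite, all products are taken over the mixture law \<open>f d\<nu>\<close>, which is a probability
  measure. The conditional probability of exceedance among the first \<open>k\<close> ranked hypotheses is thus
  the Poisson binomial tail \<open>P k\<close>. Given \<open>Z\<close>, the procedure exceeds with probability
  \<open>(1 - c) P K + c P (K + 1)\<close>, where \<open>c\<close> is the probability of the extra rejection. As
  \<open>P K \<le> \<alpha> < P (K + 1)\<close>, the choice of \<open>c\<close> makes this equal to \<open>\<alpha>\<close> if \<open>K < m\<close>; if \<open>K = m\<close>,
  the probability is \<open>P K \<le> \<alpha>\<close>.
\<close>

\<comment> \<open>keeps the simplifier from turning \<open>{1..m}\<close> into \<open>{Suc 0..m}\<close>\<close>
declare One_nat_def [simp del]

subsection \<open>Law of the states and the observations\<close>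

text \<open>Restriction to \<open>A\<close> is a bijection from functions with default
  \<open>d\<close> outside \<open>A\<close> onto extensional functions, so the distributive law
  carries over. The default form matches the value sets of \<open>Pi_pmf\<close>.\<close>

lemma prod_sum_PiE_dflt:
  fixes g :: "'a \<Rightarrow> 'b \<Rightarrow> 'c::comm_semiring_1"
  assumes "finite A" and "\<And>i. i \<in> A \<Longrightarrow> finite (B i)"
  shows "(\<Prod>i\<in>A. \<Sum>b\<in>B i. g i b) = (\<Sum>x\<in>PiE_dflt A d B. \<Prod>i\<in>A. g i (x i))"
proof -
  have "(\<Prod>i\<in>A. \<Sum>b\<in>B i. g i b) = (\<Sum>x\<in>PiE A B. \<Prod>i\<in>A. g i (x i))"
    using assms by (rule prod_sum_PiE)
  also have "\<dots> = (\<Sum>x\<in>(\<lambda>x. restrict x A) ` PiE_dflt A d B. \<Prod>i\<in>A. g i (x i))"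
    by (simp add: restrict_PiE_dflt)
  also have "\<dots> = (\<Sum>x\<in>PiE_dflt A d B. \<Prod>i\<in>A. g i (restrict x A i))"
    by (subst sum.reindex) (force simp: inj_on_def PiE_dflt_def fun_eq_iff restrict_def)+
  finally show ?thesis
    by simp
qed

context two_group_model
begin

abbreviation mix_measure :: "'z measure" where
  "mix_measure \<equiv> density \<nu> (\<lambda>z. ennreal (mixture_density \<pi> f0 f1 z))"

text \<open>Here and in \<open>nulls\<close> below, \<open>True\<close> stands for a true null hypothesis, the negation of \<open>\<theta>\<close>.\<close>

definition component :: "bool \<Rightarrow> 'z \<Rightarrow> real" where
  "component b z = (if b then (1 - \<pi>) * f0 z else \<pi> * f1 z)"

lemma component_nonneg: "0 \<le> component b z"
  using pi_range f0_nonneg f1_nonneg by (simp add: component_def)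

lemma component_measurable [measurable]: "component b \<in> borel_measurable \<nu>"
  using f0_measurable f1_measurable by (cases b) (simp_all add: component_def[abs_def])

lemma mixture_density_eq: "mixture_density \<pi> f0 f1 z = component True z + component False z"
  by (simp add: mixture_density_def component_def)

lemma mixture_density_nonneg: "0 \<le> mixture_density \<pi> f0 f1 z"
  by (simp add: mixture_density_eq component_nonneg)

lemma mixture_density_measurable [measurable]: "mixture_density \<pi> f0 f1 \<in> borel_measurable \<nu>"
  unfolding mixture_density_eq[abs_def] by measurable

lemma lfdr_measurable [measurable]: "lfdr \<pi> f0 f1 \<in> borel_measurable \<nu>"
  using f0_measurable unfolding lfdr_def[abs_def] by measurable

lemma lfdr_range: "0 \<le> lfdr \<pi> f0 f1 z" "lfdr \<pi> f0 f1 z \<le> 1"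
  using component_nonneg[of True z] component_nonneg[of False z]
  by (auto simp: lfdr_def mixture_density_def component_def divide_le_eq_1)

text \<open>Bayes' rule in multiplied-out form. It survives where the mixture density is zero: both
  nonnegative components vanish there, so the conventional value of \<open>lfdr\<close> does no
  harm.\<close>

lemma bernoulli_lfdr_mixture:
  "pmf (bernoulli_pmf (lfdr \<pi> f0 f1 z)) b * mixture_density \<pi> f0 f1 z = component b z"
proof (cases "mixture_density \<pi> f0 f1 z = 0")
  case True
  then have "component b z = 0"
    using component_nonneg[of True z] component_nonneg[of False z]
    by (cases b) (auto simp: mixture_density_eq)
  with True show ?thesis by simp
next
  case False
  then show ?thesis
    using lfdr_range[of z]
    by (cases b) (simp_all add: lfdr_def component_def mixture_density_def field_simps)
qed

lemma theta_measurable: "i \<in> {1..m} \<Longrightarrow> \<theta> i \<in> measurable M (count_space UNIV)"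
  using theta_indep by (auto simp: indep_vars_def)

lemma states_event [measurable]:
  "{\<omega> \<in> space M. \<forall>i\<in>{1..m}. \<theta> i \<omega> = t i} \<in> sets M"
proof -
  have [measurable]: "Measurable.pred M (\<lambda>\<omega>. \<theta> i \<omega> = t i)" if "i \<in> {1..m}" for i
    using theta_measurable[OF that] by measurable
  show ?thesis by measurable
qed

lemma prob_states:
  "prob {\<omega> \<in> space M. \<forall>i\<in>{1..m}. \<theta> i \<omega> = t i} = (\<Prod>i\<in>{1..m}. if t i then \<pi> else 1 - \<pi>)"
\<comment> \<open>\<open>indep_varsD_finite\<close> needs a nonempty index set; for
  \<open>m = 0\<close> the event is the whole space and the product is empty.\<close>
proof (cases "{1..m} = {}")
  case True
  then show ?thesis by (simp only: True ball_empty prod.empty) (simp add: prob_space)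
next
  case False
  have single: "prob (\<theta> i -` {t i} \<inter> space M) = (if t i then \<pi> else 1 - \<pi>)" if "i \<in> {1..m}" for i
  proof -
    have "prob (\<theta> i -` {t i} \<inter> space M) = measure (distr M (count_space UNIV) (\<theta> i)) {t i}"
      using theta_measurable[OF that] by (simp add: measure_distr)
    also have "\<dots> = pmf (bernoulli_pmf \<pi>) (t i)"
      unfolding theta_distr[OF that] by (simp add: measure_pmf_single)
    finally show ?thesis using pi_range by (cases "t i") simp_all
  qed
  have "{\<omega> \<in> space M. \<forall>i\<in>{1..m}. \<theta> i \<omega> = t i} = (\<Inter>i\<in>{1..m}. \<theta> i -` {t i} \<inter> space M)"
    using False by auto
  then have "prob {\<omega> \<in> space M. \<forall>i\<in>{1..m}. \<theta> i \<omega> = t i}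
      = prob (\<Inter>i\<in>{1..m}. \<theta> i -` {t i} \<inter> space M)"
    by simp
  also have "\<dots> = (\<Prod>i\<in>{1..m}. prob (\<theta> i -` {t i} \<inter> space M))"
    by (rule indep_varsD_finite[OF theta_indep False]) auto
  also have "\<dots> = (\<Prod>i\<in>{1..m}. if t i then \<pi> else 1 - \<pi>)"
    by (rule prod.cong) (use single in auto)
  finally show ?thesis .
qed

text \<open>Conditioning on the states is elementary: their event \<open>B\<close> has as
  probability the product of the prior weights \<open>w i\<close>, and under the conditional law the
  observations are independent with densities \<open>d i\<close>. Each prior weight is absorbed into
  its density, as \<open>w i * d i z = component (x i) z\<close>.\<close>

lemma emeasure_states_obs:
  assumes A: "\<And>i. i \<in> {1..m} \<Longrightarrow> A i \<in> sets \<nu>"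
  shows "emeasure M {\<omega> \<in> space M. (\<forall>i\<in>{1..m}. \<theta> i \<omega> = (\<not> x i)) \<and> (\<forall>i\<in>{1..m}. Z i \<omega> \<in> A i)}
    = (\<Prod>i\<in>{1..m}. \<integral>\<^sup>+z. ennreal (component (x i) z) * indicator (A i) z \<partial>\<nu>)"
proof -
  define B where "B = {\<omega> \<in> space M. \<forall>i\<in>{1..m}. \<theta> i \<omega> = (\<not> x i)}"
  define C where "C = {\<omega> \<in> space M. \<forall>i\<in>{1..m}. Z i \<omega> \<in> A i}"
  define d where "d = (\<lambda>i z. if \<not> x i then f1 z else f0 z)"
  define w where "w = (\<lambda>i. if \<not> x i then \<pi> else 1 - \<pi>)"
  have B [measurable]: "B \<in> sets M"
    unfolding B_def by (rule states_event)
  have C [measurable]: "C \<in> sets M"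
  proof -
    have [measurable]: "Measurable.pred M (\<lambda>\<omega>. Z i \<omega> \<in> A i)" if "i \<in> {1..m}" for i
      using Z_measurable[OF that] A[OF that] by measurable
    show ?thesis unfolding C_def by measurable
  qed
  have wd: "component (x i) z = w i * d i z" for i z
    by (simp add: component_def w_def d_def)
  have w: "0 \<le> w i" for i
    using pi_range by (simp add: w_def)
  have d_meas [measurable]: "d i \<in> borel_measurable \<nu>" for i
    using f0_measurable f1_measurable by (cases "x i") (simp_all add: d_def[abs_def])
  have d: "0 \<le> d i z" for i z
    using f0_nonneg f1_nonneg by (simp add: d_def)
  have factor: "(\<integral>\<^sup>+z. ennreal (component (x i) z) * indicator (A i) z \<partial>\<nu>)
      = ennreal (w i) * (\<integral>\<^sup>+z. ennreal (d i z) * indicator (A i) z \<partial>\<nu>)" if "i \<in> {1..m}" for i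
    using A[OF that] w[of i] d
    by (subst nn_integral_cmult[symmetric])
       (auto simp: wd ennreal_mult mult.assoc intro!: nn_integral_cong)
  have prob_B: "prob B = (\<Prod>i\<in>{1..m}. w i)"
    unfolding B_def w_def by (rule prob_states)
  have rhs: "(\<Prod>i\<in>{1..m}. \<integral>\<^sup>+z. ennreal (component (x i) z) * indicator (A i) z \<partial>\<nu>)
      = ennreal (prob B) * (\<Prod>i\<in>{1..m}. \<integral>\<^sup>+z. ennreal (d i z) * indicator (A i) z \<partial>\<nu>)"
    using w by (simp add: factor prod.distrib prob_B prod_ennreal)
  have "emeasure M (B \<inter> C)
      = ennreal (prob B) * (\<Prod>i\<in>{1..m}. \<integral>\<^sup>+z. ennreal (d i z) * indicator (A i) z \<partial>\<nu>)"
  \<comment> \<open>The conditional model is available only for states of positive probability;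
    otherwise both sides are zero.\<close>
  proof (cases "prob B = 0")
    case True
    have "emeasure M (B \<inter> C) \<le> emeasure M B"
      by (intro emeasure_mono) auto
    with True show ?thesis
      by (simp add: emeasure_eq_measure)
  next
    case False
    then have pos: "prob B > 0" by (simp add: zero_less_measure_iff)
    let ?U = "uniform_measure M B"
    have U: "prob_space ?U"
      using False by (intro prob_space_uniform_measure) (auto simp: emeasure_eq_measure)
    have emC: "emeasure ?U C = (\<Prod>i\<in>{1..m}. \<integral>\<^sup>+z. ennreal (d i z) * indicator (A i) z \<partial>\<nu>)"
    proof (cases "{1..m} = {}")
      case True
      then have "C = space ?U" unfolding C_def True by simp
      then show ?thesis
        using True prob_space.emeasure_space_1[OF U] by (simp only: True prod.empty)
    next
      case ne: False
      have ind: "prob_space.indep_vars ?U (\<lambda>_. \<nu>) Z {1..m}"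
        using Z_indep_given_theta[of "\<lambda>i. \<not> x i"] pos by (simp add: B_def)
      have "C = (\<Inter>i\<in>{1..m}. Z i -` A i \<inter> space ?U)"
        using ne by (auto simp: C_def)
      then have "emeasure ?U C = emeasure ?U (\<Inter>i\<in>{1..m}. Z i -` A i \<inter> space ?U)"
        by simp
      also have "\<dots> = ennreal (\<Prod>i\<in>{1..m}. measure ?U (Z i -` A i \<inter> space ?U))"
        using prob_space.indep_varsD_finite[OF U ind ne, of A] A
        by (simp add: finite_measure.emeasure_eq_measure[OF prob_space.finite_measure[OF U]])
      also have "\<dots> = (\<Prod>i\<in>{1..m}. emeasure ?U (Z i -` A i \<inter> space ?U))"
        by (simp add: prod_ennreal finite_measure.emeasure_eq_measure[OF prob_space.finite_measure[OF U]])
      also have "\<dots> = (\<Prod>i\<in>{1..m}. \<integral>\<^sup>+z. ennreal (d i z) * indicator (A i) z \<partial>\<nu>)"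
      proof (rule prod.cong[OF refl])
        fix i assume i: "i \<in> {1..m}"
        have "distributed ?U \<nu> (Z i) (\<lambda>z. ennreal (d i z))"
          using Z_distr_given_theta[of "\<lambda>i. \<not> x i" i] pos i by (simp add: B_def d_def)
        then show "emeasure ?U (Z i -` A i \<inter> space ?U)
            = (\<integral>\<^sup>+z. ennreal (d i z) * indicator (A i) z \<partial>\<nu>)"
          using A[OF i] by (rule distributed_emeasure)
      qed
      finally show ?thesis .
    qed
    have "emeasure M (B \<inter> C) = emeasure M B * emeasure ?U C"
      using pos by (simp add: emeasure_eq_measure ennreal_times_divide divide_ennreal flip: ennreal_mult)
    then show ?thesis
      by (simp add: emC emeasure_eq_measure)
  qed
  moreover have "{\<omega> \<in> space M. (\<forall>i\<in>{1..m}. \<theta> i \<omega> = (\<not> x i)) \<and> (\<forall>i\<in>{1..m}. Z i \<omega> \<in> A i)} = B \<inter> C"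
    by (auto simp: B_def C_def)
  ultimately show ?thesis
    by (simp only: rhs)
qed

end

subsection \<open>Posterior law of the null indicators\<close>

text \<open>The default \<open>False\<close> outside \<open>{1..m}\<close> agrees with
  \<open>nulls\<close> below, so this law and the actual null indicators take values in the same
  finite set \<open>null_configs m\<close>. That it is the conditional law given the observations is
  shown in \<open>prob_given_obs_nulls\<close>.\<close>

definition posterior :: "nat \<Rightarrow> real \<Rightarrow> ('z \<Rightarrow> real) \<Rightarrow> ('z \<Rightarrow> real) \<Rightarrow> (nat \<Rightarrow> 'z) \<Rightarrow> (nat \<Rightarrow> bool) pmf" where
  "posterior m \<pi> f0 f1 z = Pi_pmf {1..m} False (\<lambda>i. bernoulli_pmf (lfdr \<pi> f0 f1 (z i)))"

definition null_configs :: "nat \<Rightarrow> (nat \<Rightarrow> bool) set" where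
  "null_configs m = PiE_dflt {1..m} False (\<lambda>_. UNIV)"

lemma finite_null_configs: "finite (null_configs m)"
  by (simp add: null_configs_def finite_PiE_dflt)

lemma set_posterior: "set_pmf (posterior m \<pi> f0 f1 z) \<subseteq> null_configs m"
  unfolding posterior_def null_configs_def
  by (rule order.trans[OF set_Pi_pmf_subset']) (auto simp: PiE_dflt_def)

lemma pmf_posterior:
  "x \<in> null_configs m \<Longrightarrow>
    pmf (posterior m \<pi> f0 f1 z) x = (\<Prod>i\<in>{1..m}. pmf (bernoulli_pmf (lfdr \<pi> f0 f1 (z i))) (x i))"
  by (simp add: posterior_def null_configs_def PiE_dflt_def pmf_Pi)

text \<open>Only the coefficients of this finite sum involve \<open>S\<close>. This allows
  \<open>S\<close> to depend on the observations later, one configuration \<open>x\<close> at a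
  time.\<close>

lemma prob_posterior:
  "measure_pmf.prob (posterior m \<pi> f0 f1 z) S
    = (\<Sum>x\<in>null_configs m. of_bool (x \<in> S) * pmf (posterior m \<pi> f0 f1 z) x)"
proof -
  have "measure_pmf.prob (posterior m \<pi> f0 f1 z) S
      = measure_pmf.prob (posterior m \<pi> f0 f1 z) (S \<inter> null_configs m)"
    using set_posterior[of m \<pi> f0 f1 z] by (intro measure_prob_cong_0) (auto simp: set_pmf_eq subset_eq)
  also have "\<dots> = (\<Sum>x\<in>S \<inter> null_configs m. pmf (posterior m \<pi> f0 f1 z) x)"
    using finite_null_configs by (intro measure_measure_pmf_finite) auto
  also have "\<dots> = (\<Sum>x\<in>null_configs m. of_bool (x \<in> S) * pmf (posterior m \<pi> f0 f1 z) x)"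
    by (intro sum.mono_neutral_cong_left finite_null_configs) auto
  finally show ?thesis .
qed

context two_group_model
begin

abbreviation obs_space :: "(nat \<Rightarrow> 'z) measure" where
  "obs_space \<equiv> Pi\<^sub>M {1..m} (\<lambda>_. \<nu>)"

abbreviation obs_sigma :: "'w measure" where
  "obs_sigma \<equiv> obs_algebra M m \<nu> Z"

definition nulls :: "'w \<Rightarrow> nat \<Rightarrow> bool" where
  "nulls \<omega> i \<longleftrightarrow> i \<in> {1..m} \<and> \<not> \<theta> i \<omega>"

lemma nulls_in_configs: "nulls \<omega> \<in> null_configs m"
  by (auto simp: null_configs_def PiE_dflt_def nulls_def)

lemma nulls_eq_iff:
  "x \<in> null_configs m \<Longrightarrow> nulls \<omega> = x \<longleftrightarrow> (\<forall>i\<in>{1..m}. \<theta> i \<omega> = (\<not> x i))"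
  by (auto simp: null_configs_def PiE_dflt_def nulls_def fun_eq_iff)

lemma nulls_event [measurable]: "{\<omega> \<in> space M. nulls \<omega> = x} \<in> sets M"
proof (cases "x \<in> null_configs m")
  case True
  then show ?thesis using states_event[of "\<lambda>i. \<not> x i"] by (simp add: nulls_eq_iff)
next
  case False
  then have "{\<omega> \<in> space M. nulls \<omega> = x} = {}" using nulls_in_configs by auto
  then show ?thesis by (simp only: sets.empty_sets)
qed

lemma obs_measurable [measurable]: "obs m Z \<in> measurable M obs_space"
  unfolding obs_def[abs_def] using Z_measurable by (intro measurable_restrict) auto

section \<open>Joint law of the null indicators and the observations\<close>

lemma prob_space_mix_measure: "prob_space mix_measure"
proof
  have f0: "(\<integral>\<^sup>+z. ennreal (f0 z) \<partial>\<nu>) = 1" and f1: "(\<integral>\<^sup>+z. ennreal (f1 z) \<partial>\<nu>) = 1"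
    using prob_space.emeasure_space_1[OF F0_prob] prob_space.emeasure_space_1[OF F1_prob]
      f0_measurable f1_measurable
    by (simp_all add: emeasure_density cong: nn_integral_cong)
  have "emeasure mix_measure (space mix_measure)
      = (\<integral>\<^sup>+z. ennreal (mixture_density \<pi> f0 f1 z) \<partial>\<nu>)"
    by (simp add: emeasure_density cong: nn_integral_cong)
  also have "\<dots> = (\<integral>\<^sup>+z. ennreal (1 - \<pi>) * ennreal (f0 z) + ennreal \<pi> * ennreal (f1 z) \<partial>\<nu>)"
    using pi_range f0_nonneg f1_nonneg by (simp add: mixture_density_def ennreal_mult ennreal_plus)
  also have "\<dots> = ennreal (1 - \<pi>) + ennreal \<pi>"
    using f0_measurable f1_measurable by (simp add: nn_integral_add nn_integral_cmult f0 f1)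
  also have "\<dots> = 1"
    using pi_range by (simp flip: ennreal_plus)
  finally show "emeasure mix_measure (space mix_measure) = 1" .
qed

lemma emeasure_nulls_obs_PiE:
  assumes x: "x \<in> null_configs m" and A: "\<And>i. i \<in> {1..m} \<Longrightarrow> A i \<in> sets \<nu>"
  shows "emeasure M {\<omega> \<in> space M. nulls \<omega> = x \<and> obs m Z \<omega> \<in> Pi\<^sub>E {1..m} A}
    = (\<Prod>i\<in>{1..m}. \<integral>\<^sup>+z. ennreal (component (x i) z) * indicator (A i) z \<partial>\<nu>)"
proof -
  have "{\<omega> \<in> space M. nulls \<omega> = x \<and> obs m Z \<omega> \<in> Pi\<^sub>E {1..m} A}
      = {\<omega> \<in> space M. (\<forall>i\<in>{1..m}. \<theta> i \<omega> = (\<not> x i)) \<and> (\<forall>i\<in>{1..m}. Z i \<omega> \<in> A i)}"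
    using nulls_eq_iff[OF x] by (auto simp: obs_def PiE_iff)
  then show ?thesis
    using emeasure_states_obs[OF A] by simp
qed

text \<open>Splitting a box by the value of \<open>nulls\<close> gives a sum over configurations of
  products, which is a product over coordinates of sums. In each sum the two components add up to
  the mixture density.\<close>

lemma distr_obs: "distr M obs_space (obs m Z) = Pi\<^sub>M {1..m} (\<lambda>_. mix_measure)"
proof -
  interpret mix: prob_space mix_measure by (rule prob_space_mix_measure)
  interpret P: product_sigma_finite "\<lambda>_::nat. mix_measure" ..
  show ?thesis
  proof (rule P.PiM_eqI)
    show "sets (distr M obs_space (obs m Z)) = sets (Pi\<^sub>M {1..m} (\<lambda>_. mix_measure))"
      by (simp cong: sets_PiM_cong)
    fix A assume "\<And>i. i \<in> {1..m} \<Longrightarrow> A i \<in> sets mix_measure"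
    then have A: "A i \<in> sets \<nu>" if "i \<in> {1..m}" for i
      using that by simp
    let ?N = "\<lambda>x. {\<omega> \<in> space M. nulls \<omega> = x \<and> obs m Z \<omega> \<in> Pi\<^sub>E {1..m} A}"
    have PiA [measurable]: "Pi\<^sub>E {1..m} A \<in> sets obs_space"
      using A by (intro sets_PiM_I_finite) auto
    have N [measurable]: "?N x \<in> sets M" for x
    proof -
      have "?N x = {\<omega> \<in> space M. nulls \<omega> = x} \<inter> (obs m Z -` Pi\<^sub>E {1..m} A \<inter> space M)"
        by auto
      then show ?thesis using nulls_event by (simp add: measurable_sets[OF obs_measurable PiA])
    qed
    have "emeasure (distr M obs_space (obs m Z)) (Pi\<^sub>E {1..m} A)
        = emeasure M (\<Union>x\<in>null_configs m. ?N x)"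
      using nulls_in_configs by (auto simp: emeasure_distr intro!: arg_cong[where f="emeasure M"])
    also have "\<dots> = (\<Sum>x\<in>null_configs m. emeasure M (?N x))"
      using N by (intro sum_emeasure[symmetric] finite_null_configs) (auto simp: disjoint_family_on_def)
    also have "\<dots> = (\<Sum>x\<in>null_configs m. \<Prod>i\<in>{1..m}.
        \<integral>\<^sup>+z. ennreal (component (x i) z) * indicator (A i) z \<partial>\<nu>)"
      using A by (intro sum.cong refl emeasure_nulls_obs_PiE)
    also have "\<dots> = (\<Prod>i\<in>{1..m}. \<Sum>b\<in>UNIV.
        \<integral>\<^sup>+z. ennreal (component b z) * indicator (A i) z \<partial>\<nu>)"
      unfolding null_configs_def by (subst prod_sum_PiE_dflt) auto
    also have "\<dots> = (\<Prod>i\<in>{1..m}. emeasure mix_measure (A i))"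
    proof (rule prod.cong[OF refl])
      fix i assume "i \<in> {1..m}"
      then have [measurable]: "A i \<in> sets \<nu>" by (rule A)
      show "(\<Sum>b\<in>UNIV. \<integral>\<^sup>+z. ennreal (component b z) * indicator (A i) z \<partial>\<nu>) = emeasure mix_measure (A i)"
        by (simp add: UNIV_bool emeasure_density mixture_density_eq component_nonneg
          nn_integral_add distrib_right add.commute)
    qed
    finally show "emeasure (distr M obs_space (obs m Z)) (Pi\<^sub>E {1..m} A)
        = (\<Prod>i\<in>{1..m}. emeasure mix_measure (A i))" .
  qed auto
qed

lemma pmf_bernoulli_lfdr_measurable [measurable]:
  "(\<lambda>z. pmf (bernoulli_pmf (lfdr \<pi> f0 f1 z)) b) \<in> borel_measurable \<nu>"
  by (cases b) (simp_all add: lfdr_range lfdr_measurable)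

lemma pmf_posterior_measurable [measurable]:
  assumes "x \<in> null_configs m"
  shows "(\<lambda>z. pmf (posterior m \<pi> f0 f1 z) x) \<in> borel_measurable obs_space"
  unfolding pmf_posterior[OF assms]
proof (rule borel_measurable_prod)
  fix i assume "i \<in> {1..m}"
  then have [measurable]: "(\<lambda>z. z i) \<in> measurable obs_space \<nu>" by (rule measurable_component_singleton)
  show "(\<lambda>z. pmf (bernoulli_pmf (lfdr \<pi> f0 f1 (z i))) (x i)) \<in> borel_measurable obs_space"
    by measurable
qed

lemma nn_integral_bernoulli_lfdr_mix:
  assumes [measurable]: "A \<in> sets \<nu>"
  shows "(\<integral>\<^sup>+z. ennreal (pmf (bernoulli_pmf (lfdr \<pi> f0 f1 z)) b) * indicator A z \<partial>mix_measure)
    = (\<integral>\<^sup>+z. ennreal (component b z) * indicator A z \<partial>\<nu>)"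
proof -
  have "ennreal (mixture_density \<pi> f0 f1 z) * (ennreal (pmf (bernoulli_pmf (lfdr \<pi> f0 f1 z)) b) * indicator A z)
      = ennreal (component b z) * indicator A z" for z
    using mixture_density_nonneg[of z]
    by (simp add: bernoulli_lfdr_mixture[symmetric] ennreal_mult ac_simps)
  then show ?thesis
    by (simp add: nn_integral_density)
qed

text \<open>As the left-hand measure is finite, it is enough to compare on boxes. There the
  posterior weight of \<open>x\<close> factorizes over the coordinates, and Bayes' rule turns each
  factor into an integral of \<open>component (x i)\<close>.\<close>

lemma distr_nulls_obs:
  assumes x: "x \<in> null_configs m"
  shows "distr (density M (indicator {\<omega> \<in> space M. nulls \<omega> = x})) obs_space (obs m Z)
    = density (Pi\<^sub>M {1..m} (\<lambda>_. mix_measure)) (\<lambda>z. ennreal (pmf (posterior m \<pi> f0 f1 z) x))"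
    (is "?P = ?Q")
proof -
  interpret mix: prob_space mix_measure by (rule prob_space_mix_measure)
  interpret P: product_sigma_finite "\<lambda>_::nat. mix_measure" ..
  let ?X = "{\<omega> \<in> space M. nulls \<omega> = x}"
  have sets_mix: "sets (Pi\<^sub>M {1..m} (\<lambda>_. mix_measure)) = sets obs_space"
    by (simp cong: sets_PiM_cong)
  have emP: "emeasure ?P B = emeasure M {\<omega> \<in> space M. nulls \<omega> = x \<and> obs m Z \<omega> \<in> B}"
    if B: "B \<in> sets obs_space" for B
  proof -
    have "emeasure ?P B = emeasure (density M (indicator ?X)) (obs m Z -` B \<inter> space M)"
      using B by (simp add: emeasure_distr)
    also have "\<dots> = emeasure M (?X \<inter> (obs m Z -` B \<inter> space M))"
      using B by (subst emeasure_density) (auto simp flip: indicator_inter_arith intro: measurable_sets)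
    also have "?X \<inter> (obs m Z -` B \<inter> space M) = {\<omega> \<in> space M. nulls \<omega> = x \<and> obs m Z \<omega> \<in> B}"
      by auto
    finally show ?thesis .
  qed
  show ?thesis
  proof (rule measure_eqI_PiM_finite)
    show "finite {1..m}" by simp
    show "sets ?P = sets obs_space" by simp
    show "sets ?Q = sets obs_space" by (simp add: sets_mix)
    \<comment> \<open>The exhausting sequence is constant, since the whole space already has finite
      measure.\<close>
    show "range (\<lambda>_::nat. space obs_space) \<subseteq> prod_algebra {1..m} (\<lambda>_. \<nu>)"
      unfolding space_PiM by (auto intro!: prod_algebraI_finite)
    show "(\<Union>i::nat. space obs_space) = space obs_space" by simp
    show "emeasure ?P (space obs_space) \<noteq> \<infinity>"
      by (simp add: emP)
    fix A assume A: "\<And>i. i \<in> {1..m} \<Longrightarrow> A i \<in> sets \<nu>"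
    have PiA [measurable]: "Pi\<^sub>E {1..m} A \<in> sets obs_space"
      using A by (intro sets_PiM_I_finite) auto
    have "emeasure ?Q (Pi\<^sub>E {1..m} A)
        = (\<integral>\<^sup>+z. ennreal (pmf (posterior m \<pi> f0 f1 z) x) * indicator (Pi\<^sub>E {1..m} A) z
            \<partial>Pi\<^sub>M {1..m} (\<lambda>_. mix_measure))"
      using PiA pmf_posterior_measurable[OF x]
      by (subst emeasure_density) (simp_all add: sets_mix cong: measurable_cong_sets)
    also have "\<dots> = (\<integral>\<^sup>+z. (\<Prod>i\<in>{1..m}.
          ennreal (pmf (bernoulli_pmf (lfdr \<pi> f0 f1 (z i))) (x i)) * indicator (A i) (z i))
            \<partial>Pi\<^sub>M {1..m} (\<lambda>_. mix_measure))"
    proof (rule nn_integral_cong)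
      fix z assume "z \<in> space (Pi\<^sub>M {1..m} (\<lambda>_. mix_measure))"
      then have z: "z \<in> extensional {1..m}" by (simp add: space_PiM PiE_def)
      \<comment> \<open>Membership in a box reduces to its coordinates because \<open>z\<close> is
        extensional.\<close>
      have "indicator (Pi\<^sub>E {1..m} A) z = (\<Prod>i\<in>{1..m}. indicator (A i) (z i) :: ennreal)"
      proof (cases "z \<in> Pi\<^sub>E {1..m} A")
        case False
        with z have "\<exists>i\<in>{1..m}. z i \<notin> A i" by (auto simp: PiE_iff)
        then obtain i where "i \<in> {1..m}" "z i \<notin> A i" by blast
        then have "(\<Prod>i\<in>{1..m}. indicator (A i) (z i) :: ennreal) = 0"
          by (intro prod_zero) (auto intro!: bexI[of _ i])
        with False show ?thesis by simp
      qed (auto simp: PiE_iff)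
      then show "ennreal (pmf (posterior m \<pi> f0 f1 z) x) * indicator (Pi\<^sub>E {1..m} A) z
          = (\<Prod>i\<in>{1..m}. ennreal (pmf (bernoulli_pmf (lfdr \<pi> f0 f1 (z i))) (x i)) * indicator (A i) (z i))"
        by (simp add: pmf_posterior[OF x] prod.distrib prod_ennreal)
    qed
    also have "\<dots> = (\<Prod>i\<in>{1..m}. \<integral>\<^sup>+z.
        ennreal (pmf (bernoulli_pmf (lfdr \<pi> f0 f1 z)) (x i)) * indicator (A i) z \<partial>mix_measure)"
    proof (rule P.product_nn_integral_prod)
      fix i assume "i \<in> {1..m}"
      then have [measurable]: "A i \<in> sets \<nu>" by (rule A)
      show "(\<lambda>z. ennreal (pmf (bernoulli_pmf (lfdr \<pi> f0 f1 z)) (x i)) * indicator (A i) z)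
          \<in> borel_measurable mix_measure"
        by measurable
    qed simp
    also have "\<dots> = (\<Prod>i\<in>{1..m}. \<integral>\<^sup>+z. ennreal (component (x i) z) * indicator (A i) z \<partial>\<nu>)"
      by (intro prod.cong refl nn_integral_bernoulli_lfdr_mix A)
    also have "\<dots> = emeasure ?P (Pi\<^sub>E {1..m} A)"
      unfolding emP[OF PiA] by (rule emeasure_nulls_obs_PiE[OF x A, symmetric])
    finally show "emeasure ?P (Pi\<^sub>E {1..m} A) = emeasure ?Q (Pi\<^sub>E {1..m} A)" ..
  qed
qed

text \<open>Pulling the density from \<open>distr_nulls_obs\<close> back along
  \<open>obs m Z\<close> yields the defining identity of a conditional probability, tested on
  observation events.\<close>

lemma emeasure_nulls_obs:
  assumes x: "x \<in> null_configs m" and B [measurable]: "B \<in> sets obs_space"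
  shows "emeasure M {\<omega> \<in> space M. nulls \<omega> = x \<and> obs m Z \<omega> \<in> B}
    = (\<integral>\<^sup>+\<omega>. ennreal (pmf (posterior m \<pi> f0 f1 (obs m Z \<omega>)) x) * indicator B (obs m Z \<omega>) \<partial>M)"
proof -
  let ?X = "{\<omega> \<in> space M. nulls \<omega> = x}"
  note [measurable] = pmf_posterior_measurable[OF x]
  have "{\<omega> \<in> space M. nulls \<omega> = x \<and> obs m Z \<omega> \<in> B} = ?X \<inter> (obs m Z -` B \<inter> space M)"
    by auto
  then have "emeasure M {\<omega> \<in> space M. nulls \<omega> = x \<and> obs m Z \<omega> \<in> B}
      = emeasure (distr (density M (indicator ?X)) obs_space (obs m Z)) B"
    by (simp add: emeasure_distr emeasure_density measurable_sets[OF obs_measurable B]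
      flip: indicator_inter_arith)
  also have "\<dots> = emeasure (density (distr M obs_space (obs m Z)) (\<lambda>z. ennreal (pmf (posterior m \<pi> f0 f1 z) x))) B"
    by (simp add: distr_nulls_obs[OF x] distr_obs)
  also have "\<dots> = (\<integral>\<^sup>+\<omega>. ennreal (pmf (posterior m \<pi> f0 f1 (obs m Z \<omega>)) x) * indicator B (obs m Z \<omega>) \<partial>M)"
    by (simp add: emeasure_density nn_integral_distr)
  finally show ?thesis .
qed

section \<open>Conditional probabilities given the observations\<close>

lemma subalgebra_obs: "subalgebra M obs_sigma"
  using sets_image_in_sets[OF refl obs_measurable] by (simp add: subalgebra_def obs_algebra_def)

sublocale obs_sub: finite_measure_subalgebra M obs_sigma
  by unfold_locales (rule subalgebra_obs)

lemma obs_measurable_sigma [measurable]: "obs m Z \<in> measurable obs_sigma obs_space"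
  unfolding obs_algebra_def
  using measurable_space[OF obs_measurable] by (intro measurable_vimage_algebra1) auto

lemma sets_obs_sigmaE:
  assumes "A \<in> sets obs_sigma"
  obtains B where "B \<in> sets obs_space" "A = obs m Z -` B \<inter> space M"
  using assms measurable_space[OF obs_measurable]
  unfolding obs_algebra_def by (subst (asm) sets_vimage_algebra2) auto

text \<open>The posterior weight is a function of the observations, and
  \<open>emeasure_nulls_obs\<close> gives it the right integral over every observation event. This
  characterizes the conditional expectation almost everywhere.\<close>

lemma prob_given_obs_nulls:
  assumes x: "x \<in> null_configs m"
  shows "AE \<omega> in M. prob_given_obs M m \<nu> Z {\<omega> \<in> space M. nulls \<omega> = x} \<omega>
    = pmf (posterior m \<pi> f0 f1 (obs m Z \<omega>)) x"
  unfolding prob_given_obs_def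
proof (rule obs_sub.real_cond_exp_charact)
  let ?X = "{\<omega> \<in> space M. nulls \<omega> = x}" and ?p = "\<lambda>\<omega>. pmf (posterior m \<pi> f0 f1 (obs m Z \<omega>)) x"
  note [measurable] = pmf_posterior_measurable[OF x]
  show "integrable M (indicator ?X :: _ \<Rightarrow> real)"
    by (auto intro!: integrable_real_indicator simp: emeasure_eq_measure)
  show "?p \<in> borel_measurable obs_sigma"
    by measurable
  show "integrable M ?p"
    by (intro integrable_const_bound[where B=1]) (auto simp: pmf_le_1)
  fix A assume "A \<in> sets obs_sigma"
  then obtain B where B [measurable]: "B \<in> sets obs_space" and A: "A = obs m Z -` B \<inter> space M"
    by (rule sets_obs_sigmaE)
  have A_meas [measurable]: "A \<in> sets M"
    unfolding A by measurable
  have AX: "A \<inter> ?X = {\<omega> \<in> space M. nulls \<omega> = x \<and> obs m Z \<omega> \<in> B}"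
    by (auto simp: A)
  have "(\<integral>\<omega>\<in>A. indicator ?X \<omega> \<partial>M) = prob (A \<inter> ?X)"
    by (simp add: set_lebesgue_integral_def flip: indicator_inter_arith)
  also have "\<dots> = (\<integral>\<omega>\<in>A. ?p \<omega> \<partial>M)"
  proof -
    \<comment> \<open>The identity is available for extended nonnegative integrals; boundedness of
      \<open>?p\<close> by 1 transfers it to real ones.\<close>
    have "ennreal (prob (A \<inter> ?X)) = (\<integral>\<^sup>+\<omega>. ennreal (indicator A \<omega> * ?p \<omega>) \<partial>M)"
      unfolding emeasure_eq_measure[symmetric] AX emeasure_nulls_obs[OF x B]
      by (intro nn_integral_cong) (auto simp: A split: split_indicator)
    also have "\<dots> = ennreal (\<integral>\<omega>. indicator A \<omega> * ?p \<omega> \<partial>M)"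
      by (intro nn_integral_eq_integral integrable_const_bound[where B=1])
         (auto simp: pmf_le_1 split: split_indicator)
    finally show ?thesis
      by (simp add: set_lebesgue_integral_def)
  qed
  finally show "(\<integral>\<omega>\<in>A. indicator ?X \<omega> \<partial>M) = (\<integral>\<omega>\<in>A. ?p \<omega> \<partial>M)" .
qed

end

section \<open>Marginals of product laws and the Poisson binomial tail\<close>

lemma Pi_pmf_reindex:
  assumes B: "finite B" and h: "inj_on h A" "h ` A \<subseteq> B"
  shows "Pi_pmf A d (\<lambda>j. p (h j)) = map_pmf (\<lambda>g j. if j \<in> A then g (h j) else d) (Pi_pmf B d p)"
    (is "_ = map_pmf ?F _")
proof (rule pmf_eqI)
  fix x
  have A: "finite A"
    using inj_on_finite[OF h B] .
  show "pmf (Pi_pmf A d (\<lambda>j. p (h j))) x = pmf (map_pmf ?F (Pi_pmf B d p)) x"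
  proof (cases "\<forall>j. j \<notin> A \<longrightarrow> x j = d")
    case True
    \<comment> \<open>The preimage of \<open>x\<close> is a box: coordinates in the image of
      \<open>A\<close> are prescribed through the inverse of \<open>h\<close>, the others are free
      and contribute factors 1.\<close>
    let ?X = "\<lambda>b. if b \<in> h ` A then {x (inv_into A h b)} else UNIV"
    have "?F g = x \<longleftrightarrow> g \<in> Pi B ?X" for g
    proof -
      have "?F g = x \<longleftrightarrow> (\<forall>j\<in>A. g (h j) = x j)"
        using True by (auto simp: fun_eq_iff)
      also have "\<dots> \<longleftrightarrow> (\<forall>j\<in>A. g (h j) \<in> ?X (h j))"
        using h(1) by simp
      also have "\<dots> \<longleftrightarrow> g \<in> Pi B ?X"
        using h(2) by (auto simp: Pi_iff)
      finally show ?thesis .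
    qed
    then have vimage: "?F -` {x} = Pi B ?X"
      by auto
    have "pmf (map_pmf ?F (Pi_pmf B d p)) x = measure_pmf.prob (Pi_pmf B d p) (Pi B ?X)"
      by (simp add: pmf_map vimage)
    also have "\<dots> = (\<Prod>b\<in>B. measure_pmf.prob (p b) (?X b))"
      using B by (rule measure_Pi_pmf_Pi)
    also have "\<dots> = (\<Prod>b\<in>h ` A. pmf (p b) (x (inv_into A h b)))"
      using B h by (intro prod.mono_neutral_cong_right) (auto simp: measure_pmf_single)
    also have "\<dots> = (\<Prod>j\<in>A. pmf (p (h j)) (x j))"
      using h by (simp add: prod.reindex)
    also have "\<dots> = pmf (Pi_pmf A d (\<lambda>j. p (h j))) x"
      using True A by (simp add: pmf_Pi')
    finally show ?thesis ..
  next
    case False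
    then have "?F -` {x} = {}" by auto
    then have "pmf (map_pmf ?F (Pi_pmf B d p)) x = 0" by (simp only: pmf_map measure_empty)
    moreover have "pmf (Pi_pmf A d (\<lambda>j. p (h j))) x = 0"
      using False A by (intro pmf_Pi_outside) auto
    ultimately show ?thesis by simp
  qed
qed

text \<open>With \<open>z\<close> held fixed, the first \<open>k\<close> ranked coordinates are an
  injective reindexing of part of the posterior product law, hence independent Bernoulli variables
  with the ranked lfdr values as success probabilities.\<close>

lemma pbd_tail_posterior:
  assumes h: "bij_betw h {1..m} {1..m}" and k: "k \<le> m"
  shows "pbd_tail k (\<lambda>j. lfdr \<pi> f0 f1 (z (h j))) c
    = measure_pmf.prob (posterior m \<pi> f0 f1 z) {x. c < (\<Sum>j\<in>{1..k}. of_bool (x (h j)))}"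
proof -
  have "{1..k} \<subseteq> {1..m}" using k by simp
  then have inj: "inj_on h {1..k}" and sub: "h ` {1..k} \<subseteq> {1..m}"
    using bij_betw_imp_inj_on[OF h] bij_betw_imp_surj_on[OF h] by (blast intro: inj_on_subset)+
  have "poisson_binomial_pmf k (\<lambda>j. lfdr \<pi> f0 f1 (z (h j)))
      = map_pmf (\<lambda>x. \<Sum>j\<in>{1..k}. of_bool (x (h j))) (posterior m \<pi> f0 f1 z)"
    unfolding poisson_binomial_pmf_def posterior_def
    by (subst Pi_pmf_reindex[OF _ inj sub, where p="\<lambda>i. bernoulli_pmf (lfdr \<pi> f0 f1 (z i))"])
       (auto simp: map_pmf_comp simp del: sum_of_bool_eq intro!: map_pmf_cong sum.cong)
  then show ?thesis
    by (simp add: pbd_tail_def vimage_def)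
qed

section \<open>Events with target sets that depend on the observations\<close>

context two_group_model
begin

lemma prob_given_obs_measurable [measurable]:
  "prob_given_obs M m \<nu> Z A \<in> borel_measurable M"
  by (simp add: prob_given_obs_def)

text \<open>For each fixed \<open>x\<close>, the conditions \<open>obs m Z \<omega> \<in> B\<close>
  and \<open>x \<in> S (obs m Z \<omega>)\<close> depend on the observations only and can be pulled
  out of the conditional probability; summing over the finitely many \<open>x\<close> restores
  \<open>S\<close>. It is used with \<open>C\<close> the coin and with \<open>C\<close> always
  true.\<close>

lemma prob_obs_nulls_event:
  fixes c :: "'w \<Rightarrow> real" and S :: "(nat \<Rightarrow> 'z) \<Rightarrow> (nat \<Rightarrow> bool) set"
  assumes C [measurable]: "{\<omega> \<in> space M. C \<omega>} \<in> sets M"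
    and B [measurable]: "B \<in> sets obs_space"
    and S: "\<And>x. x \<in> null_configs m \<Longrightarrow> {z \<in> space obs_space. x \<in> S z} \<in> sets obs_space"
    and c [measurable]: "c \<in> borel_measurable M"
    and ci: "\<And>x. x \<in> null_configs m \<Longrightarrow> AE \<omega> in M. obs m Z \<omega> \<in> B \<longrightarrow>
      prob_given_obs M m \<nu> Z {\<omega> \<in> space M. C \<omega> \<and> nulls \<omega> = x} \<omega>
        = c \<omega> * pmf (posterior m \<pi> f0 f1 (obs m Z \<omega>)) x"
  defines "g \<equiv> \<lambda>\<omega>. of_bool (obs m Z \<omega> \<in> B) * c \<omega>
      * measure_pmf.prob (posterior m \<pi> f0 f1 (obs m Z \<omega>)) (S (obs m Z \<omega>))"
  shows "integrable M g"
    and "prob {\<omega> \<in> space M. C \<omega> \<and> obs m Z \<omega> \<in> B \<and> nulls \<omega> \<in> S (obs m Z \<omega>)} = (\<integral>\<omega>. g \<omega> \<partial>M)"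
    and "{\<omega> \<in> space M. C \<omega> \<and> obs m Z \<omega> \<in> B \<and> nulls \<omega> \<in> S (obs m Z \<omega>)} \<in> sets M"
proof -
  let ?D = "null_configs m"
  define p where "p x \<omega> = pmf (posterior m \<pi> f0 f1 (obs m Z \<omega>)) x" for x \<omega>
  \<comment> \<open>\<open>f x\<close> is the observation-measurable factor, \<open>N x\<close> the
    event whose conditional probability is taken, and \<open>E x\<close> the event whose indicator
    is their product.\<close>
  define f where "f x \<omega> = (of_bool (obs m Z \<omega> \<in> B \<and> x \<in> S (obs m Z \<omega>)) :: real)" for x \<omega>
  define N where "N x = {\<omega> \<in> space M. C \<omega> \<and> nulls \<omega> = x}" for x
  define E where "E x = {\<omega> \<in> space M. C \<omega> \<and> obs m Z \<omega> \<in> B \<and> nulls \<omega> = x \<and> x \<in> S (obs m Z \<omega>)}" for x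
  have N [measurable]: "N x \<in> sets M" for x
  proof -
    have "N x = {\<omega> \<in> space M. C \<omega>} \<inter> {\<omega> \<in> space M. nulls \<omega> = x}" by (auto simp: N_def)
    then show ?thesis by simp
  qed
  have f_meas: "f x \<in> borel_measurable obs_sigma" if "x \<in> ?D" for x
  proof -
    let ?B = "B \<inter> {z \<in> space obs_space. x \<in> S z}"
    have [measurable]: "?B \<in> sets obs_space" using S[OF that] by simp
    have "(\<lambda>\<omega>. indicator ?B (obs m Z \<omega>) :: real) \<in> borel_measurable obs_sigma" by measurable
    moreover have "f x \<omega> = indicator ?B (obs m Z \<omega>)" if "\<omega> \<in> space M" for \<omega>
      using measurable_space[OF obs_measurable that] by (auto simp: f_def split: split_indicator)
    ultimately show ?thesis
      by (subst measurable_cong) (auto simp: obs_algebra_def)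
  qed
  have f_meas_M [measurable]: "f x \<in> borel_measurable M" if "x \<in> ?D" for x
    using measurable_from_subalg[OF subalgebra_obs f_meas[OF that]] .
  have fN: "f x \<omega> * indicator (N x) \<omega> = indicator (E x) \<omega>" if "\<omega> \<in> space M" for x \<omega>
    using that by (auto simp: f_def N_def E_def split: split_indicator)
  have E_meas: "E x \<in> sets M" if "x \<in> ?D" for x
  proof -
    have "E x = N x \<inter> (f x -` {1} \<inter> space M)"
      by (auto simp: E_def N_def f_def)
    then show ?thesis
      using measurable_sets[OF f_meas_M[OF that], of "{1}"] by simp
  qed
  have fN_int: "integrable M (\<lambda>\<omega>. f x \<omega> * indicator (N x) \<omega>)" if "x \<in> ?D" for x
  proof -
    have "integrable M (indicator (E x) :: _ \<Rightarrow> real)"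
      using E_meas[OF that] by (simp add: emeasure_eq_measure)
    then show ?thesis
      by (simp only: fN cong: Bochner_Integration.integrable_cong)
  qed
  \<comment> \<open>Off \<open>B\<close> the factor \<open>f x\<close> vanishes; on \<open>B\<close>
    the assumed factorization applies.\<close>
  have eq: "AE \<omega> in M. f x \<omega> * prob_given_obs M m \<nu> Z (N x) \<omega> = f x \<omega> * c \<omega> * p x \<omega>"
    if "x \<in> ?D" for x
    using ci[OF that] by eventually_elim (auto simp: f_def N_def p_def)
  have p_meas [measurable]: "p x \<in> borel_measurable M" if "x \<in> ?D" for x
    unfolding p_def using pmf_posterior_measurable[OF that] by measurable
  have int: "integrable M (\<lambda>\<omega>. f x \<omega> * c \<omega> * p x \<omega>)"
    and val: "prob (E x) = (\<integral>\<omega>. f x \<omega> * c \<omega> * p x \<omega> \<partial>M)" if x: "x \<in> ?D" for x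
  proof -
    note [measurable] = f_meas_M[OF x] p_meas[OF x]
    note ce = obs_sub.real_cond_exp_intg[OF fN_int[OF x] f_meas[OF x]
        borel_measurable_indicator[OF N], folded prob_given_obs_def]
    have m1: "(\<lambda>\<omega>. f x \<omega> * c \<omega> * p x \<omega>) \<in> borel_measurable M"
      by (intro borel_measurable_times f_meas_M[OF x] p_meas[OF x] c)
    have m2: "(\<lambda>\<omega>. f x \<omega> * prob_given_obs M m \<nu> Z (N x) \<omega>) \<in> borel_measurable M"
      by (intro borel_measurable_times f_meas_M[OF x] prob_given_obs_measurable)
    \<comment> \<open>As \<open>c\<close> carries no bound, integrability is inherited from the
      conditional expectation, with which the product agrees almost everywhere.\<close>
    show "integrable M (\<lambda>\<omega>. f x \<omega> * c \<omega> * p x \<omega>)"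
      using integrable_cong_AE[OF m2 m1 eq[OF x]] ce(1) by simp
    have "prob (E x) = (\<integral>\<omega>. f x \<omega> * indicator (N x) \<omega> \<partial>M)"
      using E_meas[OF x] by (simp add: fN cong: Bochner_Integration.integral_cong)
    also have "\<dots> = (\<integral>\<omega>. f x \<omega> * prob_given_obs M m \<nu> Z (N x) \<omega> \<partial>M)"
      using ce(2) by simp
    also have "\<dots> = (\<integral>\<omega>. f x \<omega> * c \<omega> * p x \<omega> \<partial>M)"
      using eq[OF x] by (intro integral_cong_AE) auto
    finally show "prob (E x) = (\<integral>\<omega>. f x \<omega> * c \<omega> * p x \<omega> \<partial>M)" .
  qed
  have g: "g = (\<lambda>\<omega>. \<Sum>x\<in>?D. f x \<omega> * c \<omega> * p x \<omega>)"
    by (auto simp: fun_eq_iff g_def prob_posterior f_def p_def sum_distrib_left of_bool_conj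
        intro!: sum.cong)
  show "integrable M g"
    unfolding g using int by (intro Bochner_Integration.integrable_sum)
  have union: "{\<omega> \<in> space M. C \<omega> \<and> obs m Z \<omega> \<in> B \<and> nulls \<omega> \<in> S (obs m Z \<omega>)} = (\<Union>x\<in>?D. E x)"
    using nulls_in_configs by (auto simp: E_def)
  show "{\<omega> \<in> space M. C \<omega> \<and> obs m Z \<omega> \<in> B \<and> nulls \<omega> \<in> S (obs m Z \<omega>)} \<in> sets M"
    unfolding union using finite_null_configs E_meas by (intro sets.finite_UN) auto
  have "prob (\<Union>x\<in>?D. E x) = (\<Sum>x\<in>?D. prob (E x))"
    using finite_null_configs E_meas
    by (intro finite_measure_finite_Union) (auto simp: disjoint_family_on_def E_def)
  also have "\<dots> = (\<integral>\<omega>. g \<omega> \<partial>M)"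
    unfolding g using int by (simp add: val)
  finally show "prob {\<omega> \<in> space M. C \<omega> \<and> obs m Z \<omega> \<in> B \<and> nulls \<omega> \<in> S (obs m Z \<omega>)} = (\<integral>\<omega>. g \<omega> \<partial>M)"
    by (simp only: union)
qed

lemma prob_posterior_measurable:
  assumes S: "\<And>x. x \<in> null_configs m \<Longrightarrow> {z \<in> space obs_space. x \<in> S z} \<in> sets obs_space"
  shows "(\<lambda>z. measure_pmf.prob (posterior m \<pi> f0 f1 z) (S z)) \<in> borel_measurable obs_space"
  unfolding prob_posterior
proof (intro borel_measurable_sum borel_measurable_times)
  fix x assume x: "x \<in> null_configs m"
  show "(\<lambda>z. pmf (posterior m \<pi> f0 f1 z) x) \<in> borel_measurable obs_space"
    using x by (rule pmf_posterior_measurable)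
  have "(\<lambda>z. indicator {z \<in> space obs_space. x \<in> S z} z :: real) \<in> borel_measurable obs_space"
    using S[OF x] by measurable
  then show "(\<lambda>z. of_bool (x \<in> S z) :: real) \<in> borel_measurable obs_space"
    by (subst measurable_cong[where g="indicator {z \<in> space obs_space. x \<in> S z}"])
       (auto split: split_indicator)
qed

text \<open>Take \<open>C\<close> always true and \<open>c = 1\<close> in
  \<open>prob_obs_nulls_event\<close>, and test on every observation event. The set \<open>S\<close>
  may thus move with the observations.\<close>

lemma prob_given_obs_nulls_event:
  assumes S: "\<And>x. x \<in> null_configs m \<Longrightarrow> {z \<in> space obs_space. x \<in> S z} \<in> sets obs_space"
  shows "AE \<omega> in M. prob_given_obs M m \<nu> Z {\<omega> \<in> space M. nulls \<omega> \<in> S (obs m Z \<omega>)} \<omega>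
    = measure_pmf.prob (posterior m \<pi> f0 f1 (obs m Z \<omega>)) (S (obs m Z \<omega>))"
  unfolding prob_given_obs_def
proof (rule obs_sub.real_cond_exp_charact)
  let ?X = "{\<omega> \<in> space M. nulls \<omega> \<in> S (obs m Z \<omega>)}"
    and ?p = "\<lambda>z. measure_pmf.prob (posterior m \<pi> f0 f1 z) (S z)"
  have ci: "AE \<omega> in M. obs m Z \<omega> \<in> B \<longrightarrow>
      prob_given_obs M m \<nu> Z {\<omega> \<in> space M. True \<and> nulls \<omega> = x} \<omega>
        = 1 * pmf (posterior m \<pi> f0 f1 (obs m Z \<omega>)) x" if "x \<in> null_configs m" for x B
    using prob_given_obs_nulls[OF that] by eventually_elim simp
  have X [measurable]: "?X \<in> sets M"
    using prob_obs_nulls_event(3)[where C="\<lambda>_. True" and c="\<lambda>_. 1" and B="space obs_space" and S=S, OF _ _ S _ ci]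
      measurable_space[OF obs_measurable]
    by (simp cong: conj_cong)
  show "integrable M (indicator ?X :: _ \<Rightarrow> real)"
    by (auto intro!: integrable_real_indicator simp: emeasure_eq_measure)
  have p [measurable]: "?p \<in> borel_measurable obs_space"
    using S by (rule prob_posterior_measurable)
  show "(\<lambda>\<omega>. ?p (obs m Z \<omega>)) \<in> borel_measurable obs_sigma"
    by measurable
  show "integrable M (\<lambda>\<omega>. ?p (obs m Z \<omega>))"
    by (intro integrable_const_bound[where B=1]) auto
  fix A assume "A \<in> sets obs_sigma"
  then obtain B where B [measurable]: "B \<in> sets obs_space" and A: "A = obs m Z -` B \<inter> space M"
    by (rule sets_obs_sigmaE)
  have A_meas [measurable]: "A \<in> sets M"
    unfolding A by measurable
  have "(\<integral>\<omega>\<in>A. indicator ?X \<omega> \<partial>M) = prob (A \<inter> ?X)"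
    by (simp add: set_lebesgue_integral_def flip: indicator_inter_arith)
  also have "A \<inter> ?X = {\<omega> \<in> space M. True \<and> obs m Z \<omega> \<in> B \<and> nulls \<omega> \<in> S (obs m Z \<omega>)}"
    by (auto simp: A)
  also have "prob \<dots> = (\<integral>\<omega>. of_bool (obs m Z \<omega> \<in> B) * 1 * ?p (obs m Z \<omega>) \<partial>M)"
    by (rule prob_obs_nulls_event(2)) (use S ci in auto)
  also have "\<dots> = (\<integral>\<omega>\<in>A. ?p (obs m Z \<omega>) \<partial>M)"
    by (auto simp: set_lebesgue_integral_def A intro!: Bochner_Integration.integral_cong)
  finally show "(\<integral>\<omega>\<in>A. indicator ?X \<omega> \<partial>M) = (\<integral>\<omega>\<in>A. ?p (obs m Z \<omega>) \<partial>M)" .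
qed

end

subsection \<open>The oracle procedure\<close>

text \<open>Here \<open>'a\<close> is the type of outcomes and \<open>'b\<close> that of single
  observations.\<close>

locale oracle_procedure = two_group_model +
  fixes \<gamma> \<alpha> :: real and ord :: "(nat \<Rightarrow> 'b) \<Rightarrow> nat \<Rightarrow> nat" and coin :: "'a \<Rightarrow> bool"
  assumes gamma_pos: "0 < \<gamma>" and alpha_pos: "0 < \<alpha>"
    and ordering: "lfdr_ordering m \<pi> \<nu> f0 f1 ord"
    and randomization: "oracle_randomization M m \<pi> \<nu> f0 f1 \<theta> Z \<gamma> \<alpha> ord coin"
begin

abbreviation K :: "(nat \<Rightarrow> 'b) \<Rightarrow> nat" where
  "K \<equiv> oracle_K m \<pi> f0 f1 \<gamma> \<alpha> ord"

text \<open>A set of null configurations rather than of outcomes, so that the same set can be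
  measured by \<open>posterior\<close> and tested on \<open>nulls\<close>.\<close>

definition exceed :: "nat \<Rightarrow> (nat \<Rightarrow> 'b) \<Rightarrow> (nat \<Rightarrow> bool) set" where
  "exceed k z = {x. \<gamma> * real k < (\<Sum>i\<in>first_hyps m ord z k. of_bool (x i))}"

definition tail :: "nat \<Rightarrow> (nat \<Rightarrow> 'b) \<Rightarrow> real" where
  "tail k z = measure_pmf.prob (posterior m \<pi> f0 f1 z) (exceed k z)"

lemma ord_bij: "z \<in> space obs_space \<Longrightarrow> bij_betw (ord z) {1..m} {1..m}"
  using ordering by (auto simp: lfdr_ordering_def)

lemma obs_in_space: "\<omega> \<in> space M \<Longrightarrow> obs m Z \<omega> \<in> space obs_space"
  using measurable_space[OF obs_measurable] .

lemma first_hyps_subset: "z \<in> space obs_space \<Longrightarrow> first_hyps m ord z k \<subseteq> {1..m}"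
  using bij_betw_imp_surj_on[OF ord_bij] by (fastforce simp: first_hyps_def)

text \<open>Injectivity of the ranking moves the sum from indices to ranks. For fixed
  \<open>k\<close> the range of ranks no longer depends on \<open>z\<close>, so measurability in
  \<open>z\<close> rests on the summands alone.\<close>

lemma sum_first_hyps:
  assumes "z \<in> space obs_space"
  shows "(\<Sum>i\<in>first_hyps m ord z k. g i) = (\<Sum>j\<in>{j \<in> {1..m}. j \<le> k}. g (ord z j))"
proof -
  have "inj_on (ord z) {j \<in> {1..m}. j \<le> k}"
    by (rule inj_on_subset[OF bij_betw_imp_inj_on[OF ord_bij[OF assms]]]) auto
  then show ?thesis
    by (simp only: first_hyps_def sum.reindex o_def)
qed

text \<open>This turns the selection criterion, computed with the lfdr values held fixed, into a
  condition on the posterior probability of exceedance.\<close>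

lemma tail_eq_pbd_tail:
  assumes z: "z \<in> space obs_space" and k: "k \<le> m"
  shows "tail k z = pbd_tail k (\<lambda>j. lfdr \<pi> f0 f1 (z (ord z j))) (\<gamma> * real k)"
proof -
  have "{j \<in> {1..m}. j \<le> k} = {1..k}"
    using k by auto
  then have "exceed k z = {x. \<gamma> * real k < (\<Sum>j\<in>{1..k}. of_bool (x (ord z j)))}"
    unfolding exceed_def sum_first_hyps[OF z] by (simp only:)
  then show ?thesis
    by (simp only: tail_def pbd_tail_posterior[OF ord_bij[OF z] k])
qed

text \<open>For a fixed number \<open>l\<close> the summation range is fixed and each
  \<open>ord z j\<close> is measurable into a discrete space. A data-dependent \<open>k\<close>
  takes countably many values, so it can be substituted afterwards.\<close>

lemma in_exceed_measurable:
  assumes k [measurable]: "k \<in> measurable obs_space (count_space UNIV)"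
  shows "{z \<in> space obs_space. x \<in> exceed (k z) z} \<in> sets obs_space"
proof -
  have "Measurable.pred obs_space (\<lambda>z. x \<in> exceed l z)" for l
  proof -
    have [measurable]: "(\<lambda>z. of_bool (x (ord z j)) :: real) \<in> borel_measurable obs_space"
      if "j \<in> {1..m}" for j
    proof (rule measurable_compose[where N="count_space UNIV" and g="\<lambda>i. of_bool (x i)"])
      show "(\<lambda>z. ord z j) \<in> measurable obs_space (count_space UNIV)"
        using ordering that by (auto simp: lfdr_ordering_def)
    qed simp
    have "Measurable.pred obs_space
        (\<lambda>z. \<gamma> * real l < (\<Sum>j\<in>{j \<in> {1..m}. j \<le> l}. of_bool (x (ord z j))))"
      by measurable
    then show ?thesis
      by (rule measurable_cong[THEN iffD1, rotated]) (simp only: exceed_def sum_first_hyps mem_Collect_eq)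
  qed
  then have "Measurable.pred obs_space (\<lambda>z. x \<in> exceed (k z) z)"
    by (rule measurable_compose_countable) (rule k)
  then show ?thesis
    by (simp add: pred_def)
qed

section \<open>Measurability and maximality of the selected rank\<close>

lemma K_measurable [measurable]: "K \<in> measurable obs_space (count_space UNIV)"
proof -
  have tail_meas: "tail k \<in> borel_measurable obs_space" for k
    unfolding tail_def[abs_def] by (rule prob_posterior_measurable) (rule in_exceed_measurable, simp)
  have pbd [measurable]: "(\<lambda>z. pbd_tail k (\<lambda>j. lfdr \<pi> f0 f1 (z (ord z j))) (\<gamma> * real k)) \<in> borel_measurable obs_space"
    if "k \<in> {1..m}" for k
    using tail_meas[of k] that by (subst measurable_cong[OF tail_eq_pbd_tail[symmetric]]) auto
  \<comment> \<open>The disjunct \<open>k = 0\<close> mirrors \<open>insert 0\<close> in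
    \<open>oracle_K\<close>, so that \<open>K\<close> is the maximum of a set of naturals with
    measurable membership.\<close>
  have "Measurable.pred obs_space
      (\<lambda>z. k = 0 \<or> k \<in> {1..m} \<and> pbd_tail k (\<lambda>j. lfdr \<pi> f0 f1 (z (ord z j))) (\<gamma> * real k) \<le> \<alpha>)" for k
    by (cases "k \<in> {1..m}") (use pbd in simp_all)
  then have "(\<lambda>z. Max {k. k = 0 \<or> k \<in> {1..m} \<and> pbd_tail k (\<lambda>j. lfdr \<pi> f0 f1 (z (ord z j))) (\<gamma> * real k) \<le> \<alpha>})
      \<in> measurable obs_space (count_space UNIV)"
    by (rule measurable_Max_nat)
  moreover have "insert 0 {k \<in> {1..m}. P k} = {k. k = 0 \<or> k \<in> {1..m} \<and> P k}" for P
    by auto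
  ultimately show ?thesis
    by (simp only: oracle_K_def[abs_def])
qed

lemma K_cases: "K z = 0 \<or> K z \<in> {1..m} \<and> pbd_tail (K z) (\<lambda>j. lfdr \<pi> f0 f1 (z (ord z j))) (\<gamma> * real (K z)) \<le> \<alpha>"
proof -
  have "K z \<in> insert 0 {k \<in> {1..m}. pbd_tail k (\<lambda>j. lfdr \<pi> f0 f1 (z (ord z j))) (\<gamma> * real k) \<le> \<alpha>}"
    unfolding oracle_K_def by (rule Max_in) auto
  then show ?thesis by auto
qed

lemma K_le: "K z \<le> m"
  using K_cases[of z] by auto

lemma exceed_0: "exceed 0 z = {}"
proof -
  have "{j \<in> {1..m}. j \<le> 0} = {}" by auto
  then show ?thesis by (simp only: exceed_def first_hyps_def) simp
qed

text \<open>For positive \<open>K z\<close> this is the selection criterion. For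
  \<open>K z = 0\<close> the tail is zero, because an empty sum does not exceed 0.\<close>

lemma tail_K: "z \<in> space obs_space \<Longrightarrow> tail (K z) z \<le> \<alpha>"
  using K_cases[of z] tail_eq_pbd_tail[OF _ K_le] alpha_pos
  by (cases "K z = 0") (auto simp: tail_def exceed_0)

text \<open>By maximality of \<open>K z\<close> the next rank fails the criterion. Together with
  \<open>tail_K\<close> this makes the denominator of the extra rejection probability
  positive.\<close>

lemma tail_Suc_K:
  assumes z: "z \<in> space obs_space" and K: "K z < m"
  shows "\<alpha> < tail (K z + 1) z"
proof (rule ccontr)
  assume "\<not> ?thesis"
  then have "K z + 1 \<in> insert 0 {k \<in> {1..m}. pbd_tail k (\<lambda>j. lfdr \<pi> f0 f1 (z (ord z j))) (\<gamma> * real k) \<le> \<alpha>}"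
    using K tail_eq_pbd_tail[OF z, of "K z + 1"] by simp
  then have "K z + 1 \<le> K z"
    unfolding oracle_K_def by (intro Max_ge) auto
  then show False by simp
qed

text \<open>Makes the abstract conditional probabilities in \<open>extra_rejection_prob\<close>
  explicit, at \<open>K\<close> and at \<open>K + 1\<close>. For indices in \<open>{1..m}\<close>,
  \<open>1 - of_bool (\<theta> i \<omega>)\<close> is the indicator of
  \<open>nulls \<omega> i\<close>.\<close>

lemma prob_given_obs_exceed_event:
  assumes k: "k \<in> measurable obs_space (count_space UNIV)"
  shows "AE \<omega> in M. prob_given_obs M m \<nu> Z (exceed_event M m \<theta> Z \<gamma> ord k) \<omega>
    = tail (k (obs m Z \<omega>)) (obs m Z \<omega>)"
proof -
  have "(\<Sum>i\<in>first_hyps m ord (obs m Z \<omega>) l. 1 - of_bool (\<theta> i \<omega>))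
      = (\<Sum>i\<in>first_hyps m ord (obs m Z \<omega>) l. of_bool (nulls \<omega> i) :: real)" if "\<omega> \<in> space M" for \<omega> l
    using subsetD[OF first_hyps_subset[OF obs_in_space[OF that]]]
    by (intro sum.cong refl) (simp add: nulls_def of_bool_def)
  then have "exceed_event M m \<theta> Z \<gamma> ord k
      = {\<omega> \<in> space M. nulls \<omega> \<in> exceed (k (obs m Z \<omega>)) (obs m Z \<omega>)}"
    by (auto simp only: exceed_event_def exceed_def mem_Collect_eq)
  then show ?thesis
    unfolding tail_def
    using prob_given_obs_nulls_event[of "\<lambda>z. exceed (k z) z"] in_exceed_measurable[OF k] by simp
qed

section \<open>Decision vector and false discovery proportion\<close>

definition num_rejected :: "'a \<Rightarrow> nat" where
  "num_rejected \<omega> = (if coin \<omega> \<and> K (obs m Z \<omega>) < m then K (obs m Z \<omega>) + 1 else K (obs m Z \<omega>))"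

text \<open>The extra hypothesis has rank \<open>K + 1\<close>, hence the rejected set is always an
  initial segment of the ranking.\<close>

lemma oracle_decision_eq:
  "oracle_decision m \<pi> f0 f1 Z \<gamma> \<alpha> ord coin i \<omega>
    = of_bool (i \<in> first_hyps m ord (obs m Z \<omega>) (num_rejected \<omega>))"
proof -
  have "{j \<in> {1..m}. j \<le> k + 1} = insert (k + 1) {j \<in> {1..m}. j \<le> k}" if "k < m" for k
    using that by auto
  then have "first_hyps m ord z (k + 1) = insert (ord z (k + 1)) (first_hyps m ord z k)" if "k < m" for k z
    using that by (simp only: first_hyps_def image_insert)
  then show ?thesis
    by (auto simp: oracle_decision_def Let_def num_rejected_def)
qed

lemma exceedance_iff:
  assumes \<omega>: "\<omega> \<in> space M"
  shows "\<gamma> < (\<Sum>i=1..m. (1 - of_bool (\<theta> i \<omega>)) * oracle_decision m \<pi> f0 f1 Z \<gamma> \<alpha> ord coin i \<omega>)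
        / max (\<Sum>i=1..m. oracle_decision m \<pi> f0 f1 Z \<gamma> \<alpha> ord coin i \<omega>) 1
    \<longleftrightarrow> nulls \<omega> \<in> exceed (num_rejected \<omega>) (obs m Z \<omega>)"
proof -
  let ?z = "obs m Z \<omega>" and ?k = "num_rejected \<omega>"
  let ?R = "first_hyps m ord ?z ?k"
  note z = obs_in_space[OF \<omega>]
  have k: "?k \<le> m"
    using K_le[of ?z] by (auto simp: num_rejected_def)
  have R: "?R \<subseteq> {1..m}"
    using first_hyps_subset[OF z] .
  have card: "(\<Sum>i=1..m. oracle_decision m \<pi> f0 f1 Z \<gamma> \<alpha> ord coin i \<omega>) = real ?k"
  proof -
    have "(\<Sum>i=1..m. oracle_decision m \<pi> f0 f1 Z \<gamma> \<alpha> ord coin i \<omega>) = (\<Sum>i\<in>?R. 1)"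
      unfolding oracle_decision_eq using R by (intro sum.mono_neutral_cong_right) auto
    also have "\<dots> = (\<Sum>j\<in>{j \<in> {1..m}. j \<le> ?k}. 1)"
      by (rule sum_first_hyps[OF z])
    also have "{j \<in> {1..m}. j \<le> ?k} = {1..?k}"
      using k by auto
    finally show ?thesis by simp
  qed
  have false: "(\<Sum>i=1..m. (1 - of_bool (\<theta> i \<omega>)) * oracle_decision m \<pi> f0 f1 Z \<gamma> \<alpha> ord coin i \<omega>)
      = (\<Sum>i\<in>?R. of_bool (nulls \<omega> i))"
    unfolding oracle_decision_eq using R by (intro sum.mono_neutral_cong_right) (auto simp: nulls_def)
  show ?thesis
  \<comment> \<open>Without rejections the denominator is 1 rather than \<open>?k\<close>: the
    proportion is 0 and, as \<open>\<gamma>\<close> is positive, not an exceedance, in agreement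
    with \<open>exceed_0\<close>.\<close>
  proof (cases "?k = 0")
    case True
    then have "?R = {}" by (auto simp: first_hyps_def)
    then show ?thesis
      unfolding card false using gamma_pos by (simp add: True exceed_0)
  next
    case False
    then have "max (real ?k) 1 = real ?k" by simp
    moreover have "0 < real ?k" using False by simp
    ultimately show ?thesis
      unfolding card false by (simp only: exceed_def mem_Collect_eq pos_less_divide_eq)
  qed
qed

text \<open>Given the observations, the exceedance probability mixes the tails at \<open>K\<close>
  and \<open>K + 1\<close> with the coin probability as weight. It is at most \<alpha> almost
  everywhere, and integration preserves the bound.\<close>

lemma exceedance_prob_le:
  "prob {\<omega> \<in> space M. nulls \<omega> \<in> exceed (num_rejected \<omega>) (obs m Z \<omega>)} \<le> \<alpha>"
proof -
  let ?o = "obs m Z"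
  \<comment> \<open>\<open>B\<close> collects the observations for which the coin is used; its
    conditional law is prescribed only there.\<close>
  define B where "B = {z \<in> space obs_space. K z < m}"
  define c where "c = prob_given_obs M m \<nu> Z {\<omega> \<in> space M. coin \<omega>}"
  define a where "a \<omega> = tail (K (?o \<omega>)) (?o \<omega>)" for \<omega>
  define b where "b \<omega> = tail (K (?o \<omega>) + 1) (?o \<omega>)" for \<omega>
  define S0 where "S0 z = exceed (K z) z" for z
  define S1 where "S1 z = exceed (K z + 1) z" for z
  have B [measurable]: "B \<in> sets obs_space"
    unfolding B_def by measurable
  have obs_B: "?o \<omega> \<in> B \<longleftrightarrow> K (?o \<omega>) < m" if "\<omega> \<in> space M" for \<omega>
    using obs_in_space[OF that] by (simp add: B_def)
  have c_meas: "c \<in> borel_measurable M"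
    unfolding c_def by measurable
  have [measurable]: "coin \<in> measurable M (count_space UNIV)"
    using randomization by (simp add: oracle_randomization_def)
  have coin_meas: "{\<omega> \<in> space M. coin \<omega>} \<in> sets M"
    by measurable
  have S0: "{z \<in> space obs_space. x \<in> S0 z} \<in> sets obs_space" for x
    unfolding S0_def by (rule in_exceed_measurable[OF K_measurable])
  have K1: "(\<lambda>z. K z + 1) \<in> measurable obs_space (count_space UNIV)"
    by measurable
  have S1: "{z \<in> space obs_space. x \<in> S1 z} \<in> sets obs_space" for x
    unfolding S1_def by (rule in_exceed_measurable[OF K1])
  have ci: "AE \<omega> in M. ?o \<omega> \<in> B \<longrightarrow>
      prob_given_obs M m \<nu> Z {\<omega> \<in> space M. coin \<omega> \<and> nulls \<omega> = x} \<omega>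
        = c \<omega> * pmf (posterior m \<pi> f0 f1 (?o \<omega>)) x" if x: "x \<in> null_configs m" for x
  proof -
    \<comment> \<open>Conditional independence of the coin and the states, at the state vector
      complementary to \<open>x\<close>.\<close>
    have "AE \<omega> in M. K (?o \<omega>) < m \<longrightarrow>
        prob_given_obs M m \<nu> Z {\<omega> \<in> space M. coin \<omega> \<and> (\<forall>i\<in>{1..m}. \<theta> i \<omega> = (\<not> x i))} \<omega>
          = c \<omega> * prob_given_obs M m \<nu> Z {\<omega> \<in> space M. \<forall>i\<in>{1..m}. \<theta> i \<omega> = (\<not> x i)} \<omega>"
      using randomization unfolding oracle_randomization_def c_def
      by (elim conjE) (erule allE[where x="\<lambda>i. \<not> x i"], simp)
    then show ?thesis
      using prob_given_obs_nulls[OF x] unfolding nulls_eq_iff[OF x]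
      by eventually_elim (auto simp: B_def)
  qed
  have triv: "AE \<omega> in M. ?o \<omega> \<in> space obs_space \<longrightarrow>
      prob_given_obs M m \<nu> Z {\<omega> \<in> space M. True \<and> nulls \<omega> = x} \<omega>
        = 1 * pmf (posterior m \<pi> f0 f1 (?o \<omega>)) x" if "x \<in> null_configs m" for x
    using prob_given_obs_nulls[OF that] by eventually_elim simp
  \<comment> \<open>Up to inclusion, the exceedance is \<open>(E0 - E1) \<union> E2\<close>: exceedance among the first \<open>K\<close>,
    corrected where the coin moves the procedure on to rank \<open>K + 1\<close>.\<close>
  define E0 where "E0 = {\<omega> \<in> space M. True \<and> ?o \<omega> \<in> space obs_space \<and> nulls \<omega> \<in> S0 (?o \<omega>)}"
  define E1 where "E1 = {\<omega> \<in> space M. coin \<omega> \<and> ?o \<omega> \<in> B \<and> nulls \<omega> \<in> S0 (?o \<omega>)}"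
  define E2 where "E2 = {\<omega> \<in> space M. coin \<omega> \<and> ?o \<omega> \<in> B \<and> nulls \<omega> \<in> S1 (?o \<omega>)}"
  define h where "h \<omega> = (of_bool (?o \<omega> \<in> B) :: real)" for \<omega>
  have E0: "integrable M (\<lambda>\<omega>. of_bool (?o \<omega> \<in> space obs_space) * 1 * a \<omega>)"
      "prob E0 = (\<integral>\<omega>. of_bool (?o \<omega> \<in> space obs_space) * 1 * a \<omega> \<partial>M)" "E0 \<in> sets M"
    using prob_obs_nulls_event[where C="\<lambda>_. True" and c="\<lambda>_. 1" and S=S0, OF _ sets.top S0 _ triv]
    by (simp_all add: E0_def a_def tail_def S0_def)
  have E1: "integrable M (\<lambda>\<omega>. h \<omega> * c \<omega> * a \<omega>)" "prob E1 = (\<integral>\<omega>. h \<omega> * c \<omega> * a \<omega> \<partial>M)" "E1 \<in> sets M"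
    using prob_obs_nulls_event[where C=coin and S=S0, OF coin_meas B S0 c_meas ci]
    by (simp_all add: E1_def a_def tail_def S0_def h_def)
  have E2: "integrable M (\<lambda>\<omega>. h \<omega> * c \<omega> * b \<omega>)" "prob E2 = (\<integral>\<omega>. h \<omega> * c \<omega> * b \<omega> \<partial>M)" "E2 \<in> sets M"
    using prob_obs_nulls_event[where C=coin and S=S1, OF coin_meas B S1 c_meas ci]
    by (simp_all add: E2_def b_def tail_def S1_def h_def)
  have a: "(\<integral>\<omega>. of_bool (?o \<omega> \<in> space obs_space) * 1 * a \<omega> \<partial>M) = (\<integral>\<omega>. a \<omega> \<partial>M)"
    "integrable M a"
    using E0(1) obs_in_space
    by (auto intro!: Bochner_Integration.integral_cong cong: Bochner_Integration.integrable_cong)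
  have "E1 \<subseteq> E0"
    using obs_in_space by (auto simp: E0_def E1_def)
  have "{\<omega> \<in> space M. nulls \<omega> \<in> exceed (num_rejected \<omega>) (?o \<omega>)} \<subseteq> (E0 - E1) \<union> E2"
    using obs_in_space obs_B by (auto simp: E0_def E1_def E2_def S0_def S1_def num_rejected_def)
  then have "prob {\<omega> \<in> space M. nulls \<omega> \<in> exceed (num_rejected \<omega>) (?o \<omega>)} \<le> prob ((E0 - E1) \<union> E2)"
    using E0(3) E1(3) E2(3) by (intro finite_measure_mono) auto
  also have "\<dots> \<le> prob (E0 - E1) + prob E2"
    using E0(3) E1(3) E2(3) by (intro measure_Un_le) auto
  also have "\<dots> = prob E0 - prob E1 + prob E2"
    using \<open>E1 \<subseteq> E0\<close> E0(3) E1(3) by (simp add: finite_measure_Diff)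
  also have "\<dots> = (\<integral>\<omega>. a \<omega> - h \<omega> * c \<omega> * a \<omega> + h \<omega> * c \<omega> * b \<omega> \<partial>M)"
    using a E1 E2 by (simp add: E0(2))
  \<comment> \<open>The integrand is \<open>(1 - h \<omega> * c \<omega>) * a \<omega> + h \<omega>
    * c \<omega> * b \<omega>\<close>. The coin probability makes it equal to \<alpha> where
    \<open>K < m\<close>; elsewhere \<open>h\<close> vanishes and only \<open>a\<close>
    remains.\<close>
  also have "\<dots> \<le> (\<integral>\<omega>. \<alpha> \<partial>M)"
  proof (rule integral_mono_AE)
    have coin_prob: "AE \<omega> in M. K (?o \<omega>) < m \<longrightarrow>
        c \<omega> = extra_rejection_prob M m \<pi> \<nu> f0 f1 \<theta> Z \<gamma> \<alpha> ord \<omega>"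
      using randomization by (simp add: oracle_randomization_def c_def)
    show "AE \<omega> in M. a \<omega> - h \<omega> * c \<omega> * a \<omega> + h \<omega> * c \<omega> * b \<omega> \<le> \<alpha>"
      using coin_prob prob_given_obs_exceed_event[OF K_measurable]
        prob_given_obs_exceed_event[OF K1] AE_space
    proof eventually_elim
      case (elim \<omega>)
      note z = obs_in_space[OF elim(4)]
      have a_le: "a \<omega> \<le> \<alpha>"
        using tail_K[OF z] by (simp add: a_def)
      show ?case
      proof (cases "K (?o \<omega>) < m")
        case True
        then have b_gt: "\<alpha> < b \<omega>"
          using tail_Suc_K[OF z] by (simp add: b_def)
        have "c \<omega> = (\<alpha> - a \<omega>) / (b \<omega> - a \<omega>)"
          using True elim(1-3) by (simp add: extra_rejection_prob_def Let_def a_def b_def)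
        \<comment> \<open>The divisor is nonzero because
          \<open>a \<omega> \<le> \<alpha> < b \<omega>\<close>.\<close>
        then have "c \<omega> * (b \<omega> - a \<omega>) = \<alpha> - a \<omega>"
          using a_le b_gt by simp
        then show ?thesis
          using True obs_B[OF elim(4)] by (simp add: h_def algebra_simps)
      next
        case False
        then show ?thesis
          using a_le obs_B[OF elim(4)] by (simp add: h_def)
      qed
    qed
  qed (use a(2) E1(1) E2(1) in auto)
  finally show ?thesis
    by (simp add: prob_space)
qed

end

theorem proposition1:
  fixes M :: "'w measure" and \<nu> :: "'z measure"
    and m :: nat and \<pi> \<gamma> \<alpha> :: real
    and f0 f1 :: "'z \<Rightarrow> real"
    and \<theta> :: "nat \<Rightarrow> 'w \<Rightarrow> bool" and Z :: "nat \<Rightarrow> 'w \<Rightarrow> 'z"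
    and ord :: "(nat \<Rightarrow> 'z) \<Rightarrow> nat \<Rightarrow> nat" and coin :: "'w \<Rightarrow> bool"
    and \<delta> :: "nat \<Rightarrow> 'w \<Rightarrow> real"
  assumes "0 < \<gamma>" and "\<gamma> < 1" and "0 < \<alpha>" and "\<alpha> < 1"
    and "two_group_model M m \<pi> \<nu> f0 f1 \<theta> Z"
    and "lfdr_ordering m \<pi> \<nu> f0 f1 ord"
    and "oracle_randomization M m \<pi> \<nu> f0 f1 \<theta> Z \<gamma> \<alpha> ord coin"
    and "\<delta> = oracle_decision m \<pi> f0 f1 Z \<gamma> \<alpha> ord coin"
  shows "measure M {\<omega> \<in> space M.
           (\<Sum>i=1..m. (1 - of_bool (\<theta> i \<omega>)) * \<delta> i \<omega>) / max (\<Sum>i=1..m. \<delta> i \<omega>) 1 > \<gamma>} \<le> \<alpha>"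
proof -
  interpret two_group_model M m \<pi> \<nu> f0 f1 \<theta> Z by fact
  interpret oracle_procedure M m \<pi> \<nu> f0 f1 \<theta> Z \<gamma> \<alpha> ord coin
    by unfold_locales fact+
  show ?thesis
    using exceedance_prob_le exceedance_iff unfolding assms(8) by (simp cong: conj_cong)
qed

end
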